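(* Let $R$ be a commutative ring. For a polynomial $g\in R[t]$, the polarized Dedekind--Mertens number $\widetilde\mu_R(g)$ of $g$ is bounded above by the number of local generators of the content ideal $c(g)$ of $g$, i.e. $\widetilde\mu_R(g)\le\mu_R(c(g))$.
   Context: Rings are commutative with identity and $t$ is an indeterminate. For $f\in R[t]$, the content ideal $c(f)$ is the ideal of $R$ generated by the coefficients of $f$. The polarized Dedekind--Mertens number $\widetilde\mu_R(g)$ of $g\in R[t]$ is the smallest positive integer $k$ such that $$\sum_{i=1}^k c(f_ig)\,c(f_1)\cdots\widehat{c(f_i)}\cdots c(f_k)=c(f_1)\cdots c(f_k)\,c(g)$$ for all $f_1,\dots,f_k\in R[t]$, where $\widehat{c(f_i)}$ means that the factor $c(f_i)$ is omitted (an empty product of ideals is $R$). Here $\mu_R(c(g))$ denotes the number of generators needed to generate $c(g)$ locally, that is, the maximum over all maximal ideals $\mathfrak m$ of $R$ of the minimal number of generators of the ideal $c(g)R_{\mathfrak m}$ of $R_{\mathfrak m}$ (when $R$ is local this is the minimal number of generators of $c(g)$).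
   Formalization: The polynomial g is assumed nonzero: for g = 0 over a nonzero ring the polarized Dedekind–Mertens number is 1 (smallest positive integer), while the zero content ideal needs 0 generators, so the stated inequality fails; the zero ring is thereby excluded as well. *)

theory Defs
  imports
    "HOL-Algebra.UnivPoly"
    "HOL-Algebra.Ideal_Product"
    "HOL-Library.Extended_Nat"
begin

section \<open>Localization of a commutative ring\<close>

text \<open>
  The fraction \<open>a/s\<close> is the class of all pairs \<open>(b, t)\<close> with
  \<open>u(ta - sb) = 0\<close> for some \<open>u \<in> S\<close>. The ring operations are defined by taking unions over all
  representatives, and do not depend on
  the choice of representatives (see \<open>mult_fraction\<close> and \<open>add_fraction\<close>).
\<close>

definition fraction :: "('a, 'b) ring_scheme \<Rightarrow> 'a set \<Rightarrow> 'a \<Rightarrow> 'a \<Rightarrow> ('a \<times> 'a) set" where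
  "fraction R S a s = {(b, t). b \<in> carrier R \<and> t \<in> S \<and>
     (\<exists>u\<in>S. u \<otimes>\<^bsub>R\<^esub> (t \<otimes>\<^bsub>R\<^esub> a) = u \<otimes>\<^bsub>R\<^esub> (s \<otimes>\<^bsub>R\<^esub> b))}"

definition localization :: "('a, 'b) ring_scheme \<Rightarrow> 'a set \<Rightarrow> ('a \<times> 'a) set ring" where
  "localization R S = \<lparr>
     carrier = {fraction R S a s | a s. a \<in> carrier R \<and> s \<in> S},
     mult = (\<lambda>X Y. \<Union>x\<in>X. \<Union>y\<in>Y.
               fraction R S (fst x \<otimes>\<^bsub>R\<^esub> fst y) (snd x \<otimes>\<^bsub>R\<^esub> snd y)),
     one = fraction R S \<one>\<^bsub>R\<^esub> \<one>\<^bsub>R\<^esub>,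
     zero = fraction R S \<zero>\<^bsub>R\<^esub> \<one>\<^bsub>R\<^esub>,
     add = (\<lambda>X Y. \<Union>x\<in>X. \<Union>y\<in>Y.
              fraction R S ((snd y \<otimes>\<^bsub>R\<^esub> fst x) \<oplus>\<^bsub>R\<^esub> (snd x \<otimes>\<^bsub>R\<^esub> fst y))
                (snd x \<otimes>\<^bsub>R\<^esub> snd y))\<rparr>"

lemma UN_UN_const:
  assumes "X \<noteq> {}" "Y \<noteq> {}" "\<And>x y. x \<in> X \<Longrightarrow> y \<in> Y \<Longrightarrow> F x y = C"
  shows "(\<Union>x\<in>X. \<Union>y\<in>Y. F x y) = C"
  using assms by blast

locale localizing = cring R + submonoid S R for R (structure) and S
begin

lemma S_carrier [simp, intro]: "s \<in> S \<Longrightarrow> s \<in> carrier R"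
  using subset by blast

lemma fraction_refl: "a \<in> carrier R \<Longrightarrow> s \<in> S \<Longrightarrow> (a, s) \<in> fraction R S a s"
  unfolding fraction_def using one_closed by blast

lemma fraction_eqI:
  assumes a: "a \<in> carrier R" "s \<in> S" and b: "b \<in> carrier R" "t \<in> S"
    and u: "u \<in> S" "u \<otimes> (t \<otimes> a) = u \<otimes> (s \<otimes> b)"
  shows "fraction R S a s = fraction R S b t"
proof -
  have sub: "fraction R S a s \<subseteq> fraction R S b t"
    if H: "a \<in> carrier R" "s \<in> S" "b \<in> carrier R" "t \<in> S" "u \<in> S"
      "u \<otimes> (t \<otimes> a) = u \<otimes> (s \<otimes> b)" for a s b t u
  proof
    fix x assume "x \<in> fraction R S a s"
    then obtain c r v where x: "x = (c, r)" "c \<in> carrier R" "r \<in> S" "v \<in> S"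
      and v: "v \<otimes> (r \<otimes> a) = v \<otimes> (s \<otimes> c)" unfolding fraction_def by blast
    have cl: "a \<in> carrier R" "s \<in> carrier R" "b \<in> carrier R" "t \<in> carrier R" "u \<in> carrier R"
      "c \<in> carrier R" "r \<in> carrier R" "v \<in> carrier R" using H x by auto
    have "(u \<otimes> v \<otimes> s) \<otimes> (r \<otimes> b) = (v \<otimes> r) \<otimes> (u \<otimes> (s \<otimes> b))"
      using cl by (simp add: m_ac)
    also have "\<dots> = (v \<otimes> r) \<otimes> (u \<otimes> (t \<otimes> a))" using H by simp
    also have "\<dots> = (u \<otimes> t) \<otimes> (v \<otimes> (r \<otimes> a))" using cl by (simp add: m_ac)
    also have "\<dots> = (u \<otimes> t) \<otimes> (v \<otimes> (s \<otimes> c))" using v by simp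
    also have "\<dots> = (u \<otimes> v \<otimes> s) \<otimes> (t \<otimes> c)" using cl by (simp add: m_ac)
    finally have "(u \<otimes> v \<otimes> s) \<otimes> (r \<otimes> b) = (u \<otimes> v \<otimes> s) \<otimes> (t \<otimes> c)" .
    moreover have "u \<otimes> v \<otimes> s \<in> S" using H x by simp
    ultimately show "x \<in> fraction R S b t" unfolding fraction_def using x by blast
  qed
  show ?thesis
    using sub[OF a b u] sub[OF b a u(1) u(2)[symmetric]] by (rule equalityI)
qed

lemma fraction_eq_of_mem:
  assumes "a \<in> carrier R" "s \<in> S" "(b, t) \<in> fraction R S a s"
  shows "b \<in> carrier R" "t \<in> S" "fraction R S b t = fraction R S a s"
proof -
  show b: "b \<in> carrier R" "t \<in> S" using assms unfolding fraction_def by auto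
  obtain u where "u \<in> S" "u \<otimes> (t \<otimes> a) = u \<otimes> (s \<otimes> b)"
    using assms unfolding fraction_def by blast
  then show "fraction R S b t = fraction R S a s" using fraction_eqI[OF assms(1,2) b] by simp
qed

lemma fraction_eq_iff:
  assumes "a \<in> carrier R" "s \<in> S" "b \<in> carrier R" "t \<in> S"
  shows "fraction R S a s = fraction R S b t \<longleftrightarrow> (\<exists>u\<in>S. u \<otimes> (t \<otimes> a) = u \<otimes> (s \<otimes> b))"
  using fraction_eqI[OF assms] fraction_refl[OF assms(3,4)] unfolding fraction_def by fastforce

lemma mult_fraction:
  assumes a: "a \<in> carrier R" "s \<in> S" and b: "b \<in> carrier R" "t \<in> S"
  shows "fraction R S a s \<otimes>\<^bsub>localization R S\<^esub> fraction R S b t = fraction R S (a \<otimes> b) (s \<otimes> t)"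
proof -
  have "fraction R S (a' \<otimes> b') (s' \<otimes> t') = fraction R S (a \<otimes> b) (s \<otimes> t)"
    if H: "(a', s') \<in> fraction R S a s" "(b', t') \<in> fraction R S b t" for a' s' b' t'
  proof -
    obtain u where u: "a' \<in> carrier R" "s' \<in> S" "u \<in> S" "u \<otimes> (s' \<otimes> a) = u \<otimes> (s \<otimes> a')"
      using H(1) unfolding fraction_def by blast
    obtain v where v: "b' \<in> carrier R" "t' \<in> S" "v \<in> S" "v \<otimes> (t' \<otimes> b) = v \<otimes> (t \<otimes> b')"
      using H(2) unfolding fraction_def by blast
    have cl: "a \<in> carrier R" "s \<in> carrier R" "b \<in> carrier R" "t \<in> carrier R" "u \<in> carrier R"
      "v \<in> carrier R" "a' \<in> carrier R" "b' \<in> carrier R" "s' \<in> carrier R" "t' \<in> carrier R"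
      using a b u v by auto
    have "(u \<otimes> v) \<otimes> ((s \<otimes> t) \<otimes> (a' \<otimes> b')) = (u \<otimes> (s \<otimes> a')) \<otimes> (v \<otimes> (t \<otimes> b'))"
      using cl by (simp add: m_ac)
    also have "\<dots> = (u \<otimes> (s' \<otimes> a)) \<otimes> (v \<otimes> (t' \<otimes> b))" using u v by simp
    also have "\<dots> = (u \<otimes> v) \<otimes> ((s' \<otimes> t') \<otimes> (a \<otimes> b))" using cl by (simp add: m_ac)
    finally show ?thesis
      using a b u v by (intro fraction_eqI[where u = "u \<otimes> v"]) auto
  qed
  note * = this
  show ?thesis
    unfolding localization_def ring.simps monoid.simps
  proof (rule UN_UN_const)
    show "fraction R S a s \<noteq> {}" "fraction R S b t \<noteq> {}"
      using fraction_refl[OF a] fraction_refl[OF b] by blast+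
  qed (rule *, simp_all only: prod.collapse)
qed

lemma add_fraction:
  assumes a: "a \<in> carrier R" "s \<in> S" and b: "b \<in> carrier R" "t \<in> S"
  shows "fraction R S a s \<oplus>\<^bsub>localization R S\<^esub> fraction R S b t
           = fraction R S ((t \<otimes> a) \<oplus> (s \<otimes> b)) (s \<otimes> t)"
proof -
  have "fraction R S ((t' \<otimes> a') \<oplus> (s' \<otimes> b')) (s' \<otimes> t') = fraction R S ((t \<otimes> a) \<oplus> (s \<otimes> b)) (s \<otimes> t)"
    if H: "(a', s') \<in> fraction R S a s" "(b', t') \<in> fraction R S b t" for a' s' b' t'
  proof -
    obtain u where u: "a' \<in> carrier R" "s' \<in> S" "u \<in> S" "u \<otimes> (s' \<otimes> a) = u \<otimes> (s \<otimes> a')"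
      using H(1) unfolding fraction_def by blast
    obtain v where v: "b' \<in> carrier R" "t' \<in> S" "v \<in> S" "v \<otimes> (t' \<otimes> b) = v \<otimes> (t \<otimes> b')"
      using H(2) unfolding fraction_def by blast
    have cl: "a \<in> carrier R" "s \<in> carrier R" "b \<in> carrier R" "t \<in> carrier R" "u \<in> carrier R"
      "v \<in> carrier R" "a' \<in> carrier R" "b' \<in> carrier R" "s' \<in> carrier R" "t' \<in> carrier R"
      using a b u v by auto
    have "(u \<otimes> v) \<otimes> ((s \<otimes> t) \<otimes> ((t' \<otimes> a') \<oplus> (s' \<otimes> b')))
        = (v \<otimes> t \<otimes> t') \<otimes> (u \<otimes> (s \<otimes> a')) \<oplus> (u \<otimes> s \<otimes> s') \<otimes> (v \<otimes> (t \<otimes> b'))"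
      using cl by (simp add: m_ac r_distr)
    also have "\<dots> = (v \<otimes> t \<otimes> t') \<otimes> (u \<otimes> (s' \<otimes> a)) \<oplus> (u \<otimes> s \<otimes> s') \<otimes> (v \<otimes> (t' \<otimes> b))"
      using u v by simp
    also have "\<dots> = (u \<otimes> v) \<otimes> ((s' \<otimes> t') \<otimes> ((t \<otimes> a) \<oplus> (s \<otimes> b)))"
      using cl by (simp add: m_ac r_distr)
    finally show ?thesis
      using a b u v by (intro fraction_eqI[where u = "u \<otimes> v"]) auto
  qed
  note * = this
  show ?thesis
    unfolding localization_def ring.simps monoid.simps
  proof (rule UN_UN_const)
    show "fraction R S a s \<noteq> {}" "fraction R S b t \<noteq> {}"
      using fraction_refl[OF a] fraction_refl[OF b] by blast+
  qed (rule *, simp_all only: prod.collapse)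
qed

lemma fraction_carrier [intro]:
  "a \<in> carrier R \<Longrightarrow> s \<in> S \<Longrightarrow> fraction R S a s \<in> carrier (localization R S)"
  unfolding localization_def by auto

lemma localization_carrierE:
  assumes "X \<in> carrier (localization R S)"
  obtains a s where "a \<in> carrier R" "s \<in> S" "X = fraction R S a s"
  using assms unfolding localization_def by auto

lemma zero_localization: "\<zero>\<^bsub>localization R S\<^esub> = fraction R S \<zero> \<one>"
  and one_localization: "\<one>\<^bsub>localization R S\<^esub> = fraction R S \<one> \<one>"
  by (simp_all add: localization_def)

lemma cring_localization: "cring (localization R S)"
proof (rule cringI)
  let ?L = "localization R S"
  note fs = mult_fraction add_fraction zero_localization one_localization
  show "abelian_group ?L"
  proof (rule abelian_groupI)
    fix X Y assume "X \<in> carrier ?L" "Y \<in> carrier ?L"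
    then show "X \<oplus>\<^bsub>?L\<^esub> Y \<in> carrier ?L"
      by (elim localization_carrierE) (simp add: fs fraction_carrier)
  next
    show "\<zero>\<^bsub>?L\<^esub> \<in> carrier ?L" by (simp add: fs fraction_carrier)
  next
    fix X Y Z assume "X \<in> carrier ?L" "Y \<in> carrier ?L" "Z \<in> carrier ?L"
    then show "X \<oplus>\<^bsub>?L\<^esub> Y \<oplus>\<^bsub>?L\<^esub> Z = X \<oplus>\<^bsub>?L\<^esub> (Y \<oplus>\<^bsub>?L\<^esub> Z)"
      by (elim localization_carrierE) (simp add: fs m_ac a_ac r_distr)
  next
    fix X Y assume "X \<in> carrier ?L" "Y \<in> carrier ?L"
    then show "X \<oplus>\<^bsub>?L\<^esub> Y = Y \<oplus>\<^bsub>?L\<^esub> X"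
      by (elim localization_carrierE) (simp add: fs m_ac a_ac)
  next
    fix X assume "X \<in> carrier ?L"
    then show "\<zero>\<^bsub>?L\<^esub> \<oplus>\<^bsub>?L\<^esub> X = X"
      by (elim localization_carrierE) (simp add: fs)
  next
    fix X assume "X \<in> carrier ?L"
    then obtain a s where as: "a \<in> carrier R" "s \<in> S" "X = fraction R S a s"
      by (rule localization_carrierE)
    have "fraction R S (\<ominus> a) s \<oplus>\<^bsub>?L\<^esub> X = fraction R S ((s \<otimes> (\<ominus> a)) \<oplus> (s \<otimes> a)) (s \<otimes> s)"
      using as by (simp add: fs)
    also have "(s \<otimes> (\<ominus> a)) \<oplus> (s \<otimes> a) = \<zero>"
      using as by (simp add: r_minus l_neg)
    also have "fraction R S \<zero> (s \<otimes> s) = \<zero>\<^bsub>?L\<^esub>"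
      using as unfolding fs by (intro fraction_eqI[where u = \<one>]) auto
    finally show "\<exists>Y\<in>carrier ?L. Y \<oplus>\<^bsub>?L\<^esub> X = \<zero>\<^bsub>?L\<^esub>"
      using as by blast
  qed
  show "comm_monoid ?L"
  proof (rule comm_monoidI)
    fix X Y assume "X \<in> carrier ?L" "Y \<in> carrier ?L"
    then show "X \<otimes>\<^bsub>?L\<^esub> Y \<in> carrier ?L"
      by (elim localization_carrierE) (simp add: fs fraction_carrier)
  next
    show "\<one>\<^bsub>?L\<^esub> \<in> carrier ?L" by (simp add: fs fraction_carrier)
  next
    fix X Y Z assume "X \<in> carrier ?L" "Y \<in> carrier ?L" "Z \<in> carrier ?L"
    then show "X \<otimes>\<^bsub>?L\<^esub> Y \<otimes>\<^bsub>?L\<^esub> Z = X \<otimes>\<^bsub>?L\<^esub> (Y \<otimes>\<^bsub>?L\<^esub> Z)"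
      by (elim localization_carrierE) (simp add: fs m_ac)
  next
    fix X assume "X \<in> carrier ?L"
    then show "\<one>\<^bsub>?L\<^esub> \<otimes>\<^bsub>?L\<^esub> X = X"
      by (elim localization_carrierE) (simp add: fs)
  next
    fix X Y assume "X \<in> carrier ?L" "Y \<in> carrier ?L"
    then show "X \<otimes>\<^bsub>?L\<^esub> Y = Y \<otimes>\<^bsub>?L\<^esub> X"
      by (elim localization_carrierE) (simp add: fs m_ac)
  qed
  fix X Y Z assume "X \<in> carrier ?L" "Y \<in> carrier ?L" "Z \<in> carrier ?L"
  then obtain a s b t c r where A: "a \<in> carrier R" "s \<in> S" "X = fraction R S a s"
    "b \<in> carrier R" "t \<in> S" "Y = fraction R S b t" "c \<in> carrier R" "r \<in> S" "Z = fraction R S c r"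
    by (elim localization_carrierE) blast
  show "(X \<oplus>\<^bsub>?L\<^esub> Y) \<otimes>\<^bsub>?L\<^esub> Z = X \<otimes>\<^bsub>?L\<^esub> Z \<oplus>\<^bsub>?L\<^esub> Y \<otimes>\<^bsub>?L\<^esub> Z"
    unfolding A(3,6,9) using A(1,2,4,5,7,8)
    by (simp add: fs, intro fraction_eqI[where u = \<one>]) (simp_all add: m_ac r_distr l_distr)
qed

end

text \<open>
  For a prime ideal \<open>P\<close>, the local ring \<open>R\<^sub>P\<close> and the ideal \<open>I R\<^sub>P\<close> generated by the image of \<open>I\<close>.
\<close>

definition local_ring_at :: "('a, 'b) ring_scheme \<Rightarrow> 'a set \<Rightarrow> ('a \<times> 'a) set ring" where
  "local_ring_at R P = localization R (carrier R - P)"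

lemma (in primeideal) localizing_complement: "localizing R (carrier R - I)"
proof -
  have "\<one> \<notin> I" using I_notcarr one_imp_carrier by blast
  then show ?thesis
    by (intro localizing.intro submonoid.intro is_cring) (use I_prime in auto)
qed

lemma (in primeideal) cring_local_ring_at: "cring (local_ring_at R I)"
  unfolding local_ring_at_def by (rule localizing.cring_localization[OF localizing_complement])

definition extend_at :: "('a, 'b) ring_scheme \<Rightarrow> 'a set \<Rightarrow> 'a set \<Rightarrow> ('a \<times> 'a) set set" where
  "extend_at R P I = Idl\<^bsub>local_ring_at R P\<^esub> ((\<lambda>a. fraction R (carrier R - P) a \<one>\<^bsub>R\<^esub>) ` I)"

section \<open>Numbers of generators\<close>

text \<open>The value is \<open>\<infinity>\<close> if \<open>I\<close> is not finitely generated.\<close>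

definition min_num_gens :: "('a, 'b) ring_scheme \<Rightarrow> 'a set \<Rightarrow> enat" where
  "min_num_gens R I = (INF B \<in> {B. finite B \<and> B \<subseteq> carrier R \<and> Idl\<^bsub>R\<^esub> B = I}. enat (card B))"

text \<open>A supremum of extended naturals; over the zero ring (no maximal ideals) it is 0.\<close>

definition local_num_gens :: "('a, 'b) ring_scheme \<Rightarrow> 'a set \<Rightarrow> enat" where
  "local_num_gens R I =
     (SUP M \<in> {M. maximalideal M R}. min_num_gens (local_ring_at R M) (extend_at R M I))"

section \<open>Content ideals and the polarized Dedekind--Mertens number\<close>

definition content :: "('a, 'b) ring_scheme \<Rightarrow> (nat \<Rightarrow> 'a) \<Rightarrow> 'a set" where
  "content R f = Idl\<^bsub>R\<^esub> (range (coeff (UP R) f))"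

text \<open>
  Sums and products of ideals are taken in the semiring \<^term>\<open>ideals_set R\<close> of all ideals
  of \<open>R\<close>; its unit, hence its empty product, is \<^term>\<open>carrier R\<close>.
\<close>

definition polarized_DM ::
    "('a, 'b) ring_scheme \<Rightarrow> (nat \<Rightarrow> 'a) \<Rightarrow> nat \<Rightarrow> bool" where
  "polarized_DM R g k \<longleftrightarrow>
     (\<forall>f. f \<in> {1..k} \<rightarrow> carrier (UP R) \<longrightarrow>
        (\<Oplus>\<^bsub>ideals_set R\<^esub> i \<in> {1..k}.
           content R (f i \<otimes>\<^bsub>UP R\<^esub> g) \<otimes>\<^bsub>ideals_set R\<^esub>
           (\<Otimes>\<^bsub>ideals_set R\<^esub> j \<in> {1..k} - {i}. content R (f j)))
        = (\<Otimes>\<^bsub>ideals_set R\<^esub> j \<in> {1..k}. content R (f j)) \<otimes>\<^bsub>ideals_set R\<^esub> content R g)"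

text \<open>
  The value is \<open>\<infinity>\<close> if no positive integer \<open>k\<close> has the defining property. Since \<open>k\<close> is positive,
  the value for the zero polynomial is 1, although its content ideal needs 0 generators.
\<close>

definition polarized_DM_number :: "('a, 'b) ring_scheme \<Rightarrow> (nat \<Rightarrow> 'a) \<Rightarrow> enat" where
  "polarized_DM_number R g = (INF k \<in> {k. 1 \<le> k \<and> polarized_DM R g k}. enat k)"

end

theory Submission
  imports Defs "HOL-Algebra.Ring_Divisibility"
begin

text \<open>
  Localize at a maximal ideal \<open>M\<close>. By exchange, \<open>k\<close> of the coefficients of \<open>g\<close>, say
  \<open>b\<^sub>0, \<dots>\<close> at the exponents \<open>e\<^sub>0, \<dots>\<close>, generate \<open>c(g)\<close>, so that \<open>s g = \<Sum> b\<^sub>j u\<^sub>j(t)\<close> with \<open>s \<notin> M\<close>,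
  where the coefficient of \<open>u\<^sub>j\<close> at \<open>e\<^sub>i\<close> is \<open>s\<close> if \<open>i = j\<close> and \<open>0\<close> otherwise. With independent
  variables \<open>x\<^sub>i\<close>, the matrix \<open>u\<^sub>j(x\<^sub>i)\<close> is invertible up to a polynomial \<open>D\<close> with a coefficient outside
  \<open>M\<close>, and Cramer's rule writes \<open>D b\<^sub>j\<close> as a combination of the \<open>g(x\<^sub>i)\<close>. Multiplying by
  \<open>F = \<Prod> f\<^sub>i(x\<^sub>i)\<close> puts the coefficients of \<open>F D b\<^sub>j\<close> into the left-hand side of the formula; Gauss'
  lemma cancels \<open>D\<close>, and the content of \<open>F\<close> is the product of the \<open>c(f\<^sub>i)\<close>. The variables \<open>x\<^sub>i\<close> are
  realized by the Kronecker substitution \<open>x\<^sub>i = t^m\<^sub>i\<close> with rapidly growing \<open>m\<^sub>i\<close>, and Cramer's rule by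
  fraction-free elimination, one variable at a time.
\<close>

section \<open>Ideals and saturation at a prime\<close>

context cring
begin

lemma ideal_criterion:
  assumes "I \<subseteq> carrier R" "\<zero> \<in> I"
    and "\<And>x y. x \<in> I \<Longrightarrow> y \<in> I \<Longrightarrow> x \<oplus> y \<in> I"
    and mult: "\<And>r x. r \<in> carrier R \<Longrightarrow> x \<in> I \<Longrightarrow> r \<otimes> x \<in> I"
  shows "ideal I R"
proof (rule idealI[OF ring_axioms])
  show "subgroup I (add_monoid R)"
  proof (rule add.subgroupI)
    fix x assume x: "x \<in> I"
    then have "\<ominus> x = (\<ominus> \<one>) \<otimes> x" using assms(1) by (auto simp: l_minus)
    then show "\<ominus> x \<in> I" using mult[OF _ x, of "\<ominus> \<one>"] by simp
  qed (use assms in auto)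
next
  fix a x assume "a \<in> I" "x \<in> carrier R"
  then show "x \<otimes> a \<in> I" "a \<otimes> x \<in> I"
    using mult[of x a] assms(1) by (auto simp: m_comm subset_iff)
qed

text \<open>Zorn's lemma applies to the ideals above \<open>I\<close> that avoid
  \<open>\<one>\<close>: this condition survives unions of nonempty chains, and for an ideal it
  means being proper.\<close>

lemma exists_maximalideal:
  assumes "ideal I R" "I \<noteq> carrier R"
  obtains M where "maximalideal M R" "I \<subseteq> M"
proof -
  let ?A = "{J. ideal J R \<and> I \<subseteq> J \<and> \<one> \<notin> J}"
  have "\<exists>M\<in>?A. \<forall>X\<in>?A. M \<subseteq> X \<longrightarrow> X = M"
  proof (rule subset_Zorn_nonempty)
    have "I \<in> ?A" using assms ideal.one_imp_carrier[OF assms(1)] by auto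
    then show "?A \<noteq> {}" by (rule ex_in_conv[THEN iffD1, OF exI])
    fix C assume C: "C \<noteq> {}" "subset.chain ?A C"
    then have sub: "C \<subseteq> ?A" by (simp add: pred_on.chain_def)
    from C(2) have "subset.chain {J. ideal J R} C" by (simp add: pred_on.chain_def subset_iff)
    from chain_Union_is_ideal[OF this] C(1) have "ideal (\<Union>C) R" by simp
    then show "\<Union>C \<in> ?A" using sub C(1) by (simp add: subset_iff) (meson Union_upper ex_in_conv order_trans)
  qed
  then obtain M where M: "ideal M R" "I \<subseteq> M" "\<one> \<notin> M"
    and max: "\<forall>X\<in>?A. M \<subseteq> X \<longrightarrow> X = M" by (elim bexE CollectE conjE) simp
  have "maximalideal M R"
  proof (rule maximalidealI[OF M(1)])
    show "carrier R \<noteq> M" using M(3) by auto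
    fix J assume J: "ideal J R" "M \<subseteq> J" "J \<subseteq> carrier R"
    show "J = M \<or> J = carrier R"
      using max J M(2) ideal.one_imp_carrier[OF J(1)] by auto
  qed
  with M(2) that show ?thesis by blast
qed

lemma ideal_prod_subset:
  assumes "ideal K R" "\<And>i j. i \<in> I \<Longrightarrow> j \<in> J \<Longrightarrow> i \<otimes> j \<in> K"
  shows "I \<cdot> J \<subseteq> K"
proof
  interpret K: ideal K R by fact
  fix x assume "x \<in> I \<cdot> J"
  then show "x \<in> K" by induct (auto simp: assms)
qed

lemma ideal_prod_mono:
  assumes "I \<subseteq> I'" "J \<subseteq> J'"
  shows "I \<cdot> J \<subseteq> I' \<cdot> J'"
proof
  fix x assume "x \<in> I \<cdot> J"
  then show "x \<in> I' \<cdot> J'" by induct (use assms in \<open>auto intro: ideal_prod.intros\<close>)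
qed

lemma ideal_prod_Idl_subset:
  assumes "S \<subseteq> carrier R" "T \<subseteq> carrier R" "ideal K R"
    and st: "\<And>s t. s \<in> S \<Longrightarrow> t \<in> T \<Longrightarrow> s \<otimes> t \<in> K"
  shows "(Idl S) \<cdot> (Idl T) \<subseteq> K"
proof (rule ideal_prod_subset[OF assms(3)])
  interpret K: ideal K R by fact
  fix x y assume x: "x \<in> Idl S" and y: "y \<in> Idl T"
  \<comment> \<open>The colon ideal of \<open>K\<close> by \<open>T\<close>. With \<open>T\<close>
    itself it carries the hypothesis from \<open>S\<close> to \<open>Idl S\<close>; with
    \<open>{x}\<close> it then carries it from \<open>T\<close> to \<open>Idl T\<close>.\<close>
  let ?X = "\<lambda>T. {x \<in> carrier R. \<forall>t\<in>T. x \<otimes> t \<in> K}"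
  have *: "ideal (?X T) R" if "T \<subseteq> carrier R" for T
    using that by (intro ideal_criterion) (auto simp: l_distr m_assoc subset_iff intro: K.I_l_closed)
  have "S \<subseteq> ?X T" using st assms(1) by auto
  then have "x \<in> ?X T" using genideal_minimal[OF *[OF assms(2)]] x by blast
  then have xc: "x \<in> carrier R" and "T \<subseteq> ?X {x}"
    using assms(2) by (auto simp: m_comm[of _ x] subset_iff)
  then have "y \<in> ?X {x}" using genideal_minimal[OF *[of "{x}"]] y by blast
  then show "x \<otimes> y \<in> K" using xc by (auto simp: m_comm)
qed

text \<open>The sums of this form already make up an ideal containing \<open>b\<close> and
  \<open>B\<close>.\<close>

lemma Idl_insertE:
  assumes "b \<in> carrier R" "B \<subseteq> carrier R" "x \<in> Idl (insert b B)"
  obtains r y where "r \<in> carrier R" "y \<in> Idl B" "x = (r \<otimes> b) \<oplus> y"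
proof -
  interpret B: ideal "Idl B" R using assms by (intro genideal_ideal)
  let ?K = "{(r \<otimes> b) \<oplus> y | r y. r \<in> carrier R \<and> y \<in> Idl B}"
  have "ideal ?K R"
  proof (rule ideal_criterion)
    show "?K \<subseteq> carrier R" using assms by (auto dest: B.Icarr)
    show "\<zero> \<in> ?K" using assms by (auto intro!: exI[of _ \<zero>])
    fix x y assume "x \<in> ?K" "y \<in> ?K"
    then obtain r y' s z' where *: "r \<in> carrier R" "y' \<in> Idl B" "x = (r \<otimes> b) \<oplus> y'"
      "s \<in> carrier R" "z' \<in> Idl B" "y = (s \<otimes> b) \<oplus> z'" by blast
    then have "x \<oplus> y = ((r \<oplus> s) \<otimes> b) \<oplus> (y' \<oplus> z')"
      using assms by (auto simp: l_distr a_ac dest!: B.Icarr)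
    then show "x \<oplus> y \<in> ?K" using * by blast
  next
    fix t x assume t: "t \<in> carrier R" and "x \<in> ?K"
    then obtain r y' where *: "r \<in> carrier R" "y' \<in> Idl B" "x = (r \<otimes> b) \<oplus> y'" by blast
    then have "t \<otimes> x = ((t \<otimes> r) \<otimes> b) \<oplus> (t \<otimes> y')"
      using assms t by (auto simp: r_distr m_assoc dest!: B.Icarr)
    then show "t \<otimes> x \<in> ?K" using * t by (auto intro: B.I_l_closed)
  qed
  moreover have "b \<in> ?K" using assms
    by (intro CollectI exI[of _ \<one>] exI[of _ \<zero>]) auto
  moreover have "B \<subseteq> ?K"
  proof
    fix y assume "y \<in> B"
    then show "y \<in> ?K" using assms genideal_self[OF assms(2)]
      by (intro CollectI exI[of _ \<zero>] exI[of _ y]) auto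
  qed
  ultimately show ?thesis using genideal_minimal[of ?K "insert b B"] assms(3) that by blast
qed

lemma Idl_empty: "Idl {} = {\<zero>}"
proof -
  have "ideal (Idl {}) R" by (intro genideal_ideal) simp
  then have "\<zero> \<in> Idl {}" by (simp add: additive_subgroup.zero_closed ideal.axioms(1))
  then show ?thesis using genideal_minimal[OF zeroideal, of "{}"] by blast
qed

text \<open>The coefficients belong to the indices and not to the elements \<open>b j\<close>, which
  may repeat: in \<open>pivot_coefficients\<close> different exponents can carry equal coefficients
  of \<open>g\<close>.\<close>

lemma Idl_image_lessThanE:
  fixes k :: nat
  assumes "\<And>j. j < k \<Longrightarrow> b j \<in> carrier R" "x \<in> Idl (b ` {..<k})"
  obtains u where "\<And>j. u j \<in> carrier R" "x = (\<Oplus>j\<in>{..<k}. u j \<otimes> b j)"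
  using assms
proof (induct k arbitrary: x thesis)
  case 0
  then show ?case by (auto simp: Idl_empty intro!: 0(1)[of "\<lambda>_. \<zero>"])
next
  case (Suc k)
  have "x \<in> Idl (insert (b k) (b ` {..<k}))" using Suc.prems(3) by (simp add: lessThan_Suc)
  then obtain r y where r: "r \<in> carrier R" "y \<in> Idl (b ` {..<k})" "x = (r \<otimes> b k) \<oplus> y"
    using Suc.prems(2) by (elim Idl_insertE[rotated 2]) auto
  from r(2) Suc.hyps[of y] Suc.prems(2) obtain u
    where u: "\<And>j. u j \<in> carrier R" "y = (\<Oplus>j\<in>{..<k}. u j \<otimes> b j)"
    by (metis less_SucI)
  have "(\<Oplus>j\<in>{..<k}. (u(k := r)) j \<otimes> b j) = y"
    unfolding u(2) using u(1) Suc.prems(2) by (intro finsum_cong') auto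
  then have "x = (\<Oplus>j\<in>{..<Suc k}. (u(k := r)) j \<otimes> b j)"
    using r(1,3) u(1) Suc.prems(2) by (subst lessThan_Suc, subst finsum_insert) auto
  then show ?case using Suc.prems(1)[of "u(k := r)"] r(1) u(1) by auto
qed

end

text \<open>The preimage in \<open>R\<close> of the extension of \<open>I\<close> to the localization at \<open>M\<close>.\<close>

definition saturation :: "('a, 'b) ring_scheme \<Rightarrow> 'a set \<Rightarrow> 'a set \<Rightarrow> 'a set" where
  "saturation R M I = {x \<in> carrier R. \<exists>s\<in>carrier R - M. s \<otimes>\<^bsub>R\<^esub> x \<in> I}"

context primeideal
begin

lemma compl_mult: "s \<in> carrier R - I \<Longrightarrow> t \<in> carrier R - I \<Longrightarrow> s \<otimes> t \<in> carrier R - I"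
  using I_prime by auto

lemma one_compl: "\<one> \<in> carrier R - I"
  using I_notcarr one_imp_carrier by auto

lemma saturation_ideal:
  assumes "ideal J R"
  shows "ideal (saturation R I J) R"
proof (rule ideal_criterion)
  interpret J: ideal J R by fact
  show "saturation R I J \<subseteq> carrier R" "\<zero> \<in> saturation R I J"
    using one_compl by (auto simp: saturation_def)
  fix x y assume "x \<in> saturation R I J" "y \<in> saturation R I J"
  then obtain s t where *: "x \<in> carrier R" "y \<in> carrier R" "s \<in> carrier R - I" "t \<in> carrier R - I"
    "s \<otimes> x \<in> J" "t \<otimes> y \<in> J" by (auto simp: saturation_def)
  have "(s \<otimes> t) \<otimes> (x \<oplus> y) = t \<otimes> (s \<otimes> x) \<oplus> s \<otimes> (t \<otimes> y)"
    using * by (simp add: r_distr m_ac)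
  also have "\<dots> \<in> J" using * by (auto intro: J.I_l_closed)
  finally show "x \<oplus> y \<in> saturation R I J"
    using * compl_mult[of s t] by (auto simp: saturation_def)
next
  interpret J: ideal J R by fact
  fix r x assume r: "r \<in> carrier R" "x \<in> saturation R I J"
  then obtain s where *: "x \<in> carrier R" "s \<in> carrier R - I" "s \<otimes> x \<in> J"
    by (auto simp: saturation_def)
  have "s \<otimes> (r \<otimes> x) = r \<otimes> (s \<otimes> x)" using r * by (simp add: m_ac)
  also have "\<dots> \<in> J" using r * by (auto intro: J.I_l_closed)
  finally show "r \<otimes> x \<in> saturation R I J" using r * by (auto simp: saturation_def)
qed

lemma subset_saturation:
  assumes "J \<subseteq> carrier R"
  shows "J \<subseteq> saturation R I J"
  using assms one_compl by (force simp: saturation_def)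

text \<open>Supplies the cancellation hypothesis \<open>sat\<close> of
  \<open>poly_ideal_cancel\<close> when the ideal there is a saturation.\<close>

lemma saturation_cancel:
  assumes "s \<in> carrier R - I" "x \<in> carrier R" "s \<otimes> x \<in> saturation R I J"
  shows "x \<in> saturation R I J"
proof -
  obtain t where t: "t \<in> carrier R - I" "t \<otimes> (s \<otimes> x) \<in> J"
    using assms by (auto simp: saturation_def)
  then have "(t \<otimes> s) \<otimes> x \<in> J" using assms by (simp add: m_assoc)
  then show ?thesis using assms t compl_mult[of t s] by (auto simp: saturation_def)
qed

text \<open>Transitivity of local generation: what \<open>A\<close> generates locally lies locally
  in every ideal that contains \<open>A\<close> locally.\<close>

lemma Idl_subset_saturation:
  assumes "A \<subseteq> saturation R I J" "ideal J R"
  shows "saturation R I (Idl A) \<subseteq> saturation R I J"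
proof
  fix x assume "x \<in> saturation R I (Idl A)"
  then obtain s where s: "s \<in> carrier R - I" "x \<in> carrier R" "s \<otimes> x \<in> Idl A"
    by (auto simp: saturation_def)
  then have "s \<otimes> x \<in> saturation R I J"
    using genideal_minimal[OF saturation_ideal[OF assms(2)] assms(1)] by blast
  then show "x \<in> saturation R I J" using saturation_cancel s by blast
qed

text \<open>Clearing denominators: the product of the individual multipliers works for every element
  and stays outside the prime.\<close>

lemma saturation_common_multiplier:
  assumes "finite X" "ideal J R" "X \<subseteq> saturation R I J"
  obtains s where "s \<in> carrier R - I" "\<And>x. x \<in> X \<Longrightarrow> s \<otimes> x \<in> J"
  using assms
proof (induct X arbitrary: thesis rule: finite_induct)
  case empty
  then show ?case using one_compl by blast
next
  case (insert y X)
  interpret J: ideal J R by fact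
  from insert.hyps(3) insert.prems obtain s where
    s: "s \<in> carrier R - I" "\<And>x. x \<in> X \<Longrightarrow> s \<otimes> x \<in> J" by blast
  from insert.prems(3) obtain t where t: "t \<in> carrier R - I" "y \<in> carrier R" "t \<otimes> y \<in> J"
    by (auto simp: saturation_def)
  have X: "X \<subseteq> carrier R" using insert.prems(3) by (auto simp: saturation_def)
  show ?case
  proof (rule insert.prems(1))
    show "s \<otimes> t \<in> carrier R - I" using s t compl_mult by blast
    fix x assume "x \<in> insert y X"
    then show "s \<otimes> t \<otimes> x \<in> J"
    proof
      assume "x = y"
      then show ?thesis using s t J.I_l_closed[of "t \<otimes> y" s] by (simp add: m_assoc)
    next
      assume x: "x \<in> X"
      then have "s \<otimes> t \<otimes> x = t \<otimes> (s \<otimes> x)" using s t X by (auto simp: m_ac subset_iff)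
      then show ?thesis using s(2)[OF x] t by (auto intro: J.I_l_closed)
    qed
  qed
qed

end

text \<open>The multipliers taking \<open>x\<close> into \<open>I\<close> form an ideal. If it were
  proper, it would lie in some maximal \<open>M\<close>, but local membership at \<open>M\<close>
  gives a multiplier outside \<open>M\<close>.\<close>

lemma (in cring) mem_of_local:
  assumes "ideal I R" "x \<in> carrier R" "\<And>M. maximalideal M R \<Longrightarrow> x \<in> saturation R M I"
  shows "x \<in> I"
proof -
  interpret I: ideal I R by fact
  let ?A = "{r \<in> carrier R. r \<otimes> x \<in> I}"
  have A: "ideal ?A R"
    by (rule ideal_criterion) (auto simp: assms l_distr m_assoc intro: I.I_l_closed)
  have "?A = carrier R"
  proof (rule ccontr)
    assume "?A \<noteq> carrier R"
    then obtain M where M: "maximalideal M R" "?A \<subseteq> M" using exists_maximalideal[OF A] by blast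
    then show False using assms(3)[OF M(1)] by (auto simp: saturation_def)
  qed
  then have "\<one> \<otimes> x \<in> I" by blast
  then show ?thesis using assms by simp
qed

section \<open>Local generators\<close>

text \<open>Bounds the extension of \<open>I\<close> from above: its elements are fractions with
  numerator in \<open>I\<close>.\<close>

lemma (in localizing) fractions_ideal:
  assumes "ideal I R"
  shows "ideal {fraction R S x s | x s. x \<in> I \<and> s \<in> S} (localization R S)"
proof -
  interpret I: ideal I R by fact
  interpret L: cring "localization R S" by (rule cring_localization)
  let ?F = "{fraction R S x s | x s. x \<in> I \<and> s \<in> S}"
  show ?thesis
  proof (rule L.ideal_criterion)
    show "?F \<subseteq> carrier (localization R S)" by (auto dest: I.Icarr)
    show "\<zero>\<^bsub>localization R S\<^esub> \<in> ?F" unfolding zero_localization using I.zero_closed one_closed by blast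
    fix X Y assume "X \<in> ?F" "Y \<in> ?F"
    then obtain x s y t where *: "x \<in> I" "s \<in> S" "X = fraction R S x s"
      "y \<in> I" "t \<in> S" "Y = fraction R S y t" by blast
    have "X \<oplus>\<^bsub>localization R S\<^esub> Y = fraction R S ((t \<otimes> x) \<oplus> (s \<otimes> y)) (s \<otimes> t)"
      using * I.Icarr by (simp add: add_fraction)
    moreover have "(t \<otimes> x) \<oplus> (s \<otimes> y) \<in> I" "s \<otimes> t \<in> S"
      using * by (auto intro: I.I_l_closed)
    ultimately show "X \<oplus>\<^bsub>localization R S\<^esub> Y \<in> ?F" by blast
  next
    fix Q X assume "Q \<in> carrier (localization R S)" "X \<in> ?F"
    then obtain x s a t where *: "x \<in> I" "s \<in> S" "X = fraction R S x s"
      "a \<in> carrier R" "t \<in> S" "Q = fraction R S a t" by (auto elim!: localization_carrierE)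
    have "Q \<otimes>\<^bsub>localization R S\<^esub> X = fraction R S (a \<otimes> x) (t \<otimes> s)"
      using * I.Icarr by (simp add: mult_fraction)
    moreover have "a \<otimes> x \<in> I" "t \<otimes> s \<in> S" using * by (auto intro: I.I_l_closed)
    ultimately show "Q \<otimes>\<^bsub>localization R S\<^esub> X \<in> ?F" by blast
  qed
qed

text \<open>The numerators of generators of the extended ideal also generate it, since denominators
  are units. An equality of fractions becomes membership in \<open>Idl B\<close> after
  multiplication by an element outside the prime.\<close>

lemma (in primeideal) local_generators:
  assumes J: "ideal J R" and le: "min_num_gens (local_ring_at R I) (extend_at R I J) \<le> enat k"
  obtains B where "finite B" "B \<subseteq> J" "card B \<le> k" "J \<subseteq> saturation R I (Idl B)"
proof -
  define S where "S = carrier R - I"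
  interpret loc: localizing R S unfolding S_def by (rule localizing_complement)
  let ?L = "localization R S"
  interpret L: cring ?L by (rule loc.cring_localization)
  interpret J: ideal J R by fact
  let ?E = "extend_at R I J" and ?j = "\<lambda>a. fraction R S a \<one>"
  let ?fr = "\<lambda>K. {fraction R S x s | x s. x \<in> K \<and> s \<in> S}"
  \<comment> \<open>A strict bound on an infimum unfolds into a witness.\<close>
  have "min_num_gens ?L ?E < enat (Suc k)"
    using le by (simp add: local_ring_at_def S_def) (meson enat_ord_simps(2) le_less_trans lessI)
  then obtain C where C: "finite C" "C \<subseteq> carrier ?L" "Idl\<^bsub>?L\<^esub> C = ?E" "card C \<le> k"
    unfolding min_num_gens_def by (auto simp: INF_less_iff)
  have E: "?E = Idl\<^bsub>?L\<^esub> (?j ` J)" by (simp add: extend_at_def local_ring_at_def S_def)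
  have JL: "?j ` J \<subseteq> carrier ?L" by (auto dest: J.Icarr)
  have "?E \<subseteq> ?fr J" unfolding E
    by (rule L.genideal_minimal[OF loc.fractions_ideal[OF J]]) (use loc.one_closed in blast)
  then have "\<forall>X\<in>C. \<exists>x s. x \<in> J \<and> s \<in> S \<and> X = fraction R S x s"
    using L.genideal_self[OF C(2)] C(3) by blast
  then obtain x s where xs: "\<And>X. X \<in> C \<Longrightarrow> x X \<in> J \<and> s X \<in> S \<and> X = fraction R S (x X) (s X)"
    by metis
  let ?B = "x ` C"
  have BJ: "?B \<subseteq> J" using xs by auto
  then have BR: "?B \<subseteq> carrier R" using J.Icarr by blast
  then interpret B: ideal "Idl ?B" R by (rule genideal_ideal)
  have "C \<subseteq> ?fr (Idl ?B)" using xs genideal_self[OF BR] by blast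
  then have EB: "?E \<subseteq> ?fr (Idl ?B)"
    using L.genideal_minimal[OF loc.fractions_ideal[OF B.is_ideal]] C(3) by blast
  have "J \<subseteq> saturation R I (Idl ?B)"
  proof
    fix y assume y: "y \<in> J"
    then have "?j y \<in> ?E" unfolding E using L.genideal_self[OF JL] by blast
    then obtain z t where z: "z \<in> Idl ?B" "t \<in> S" "?j y = fraction R S z t" using EB by blast
    then obtain u where u: "u \<in> S" "u \<otimes> (t \<otimes> y) = u \<otimes> (\<one> \<otimes> z)"
      using loc.fraction_eq_iff[of y \<one> z t] y J.Icarr B.Icarr by auto
    have "(u \<otimes> t) \<otimes> y = u \<otimes> z" using u z y J.Icarr B.Icarr by (simp add: m_assoc)
    then have "(u \<otimes> t) \<otimes> y \<in> Idl ?B" using u z by (simp add: B.I_l_closed)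
    moreover have "u \<otimes> t \<in> carrier R - I"
      using compl_mult[of u t] u(1) z(2) unfolding S_def by blast
    ultimately show "y \<in> saturation R I (Idl ?B)" using y J.Icarr by (auto simp: saturation_def)
  qed
  then show ?thesis using that[of ?B] C BJ card_image_le[OF C(1), of x] by auto
qed

text \<open>If no element of \<open>G\<close> can replace \<open>b\<close>, then locally \<open>G\<close>, hence \<open>b\<close> itself, lies in the ideal
  generated by \<open>B\<close> and \<open>I b\<close>, and \<open>b\<close> is redundant as in Nakayama's lemma.\<close>

lemma (in primeideal) exchange_or_drop:
  assumes G: "G \<subseteq> carrier R" and b: "b \<in> carrier R" "b \<in> saturation R I (Idl G)"
    and B: "B \<subseteq> carrier R" and GB: "G \<subseteq> saturation R I (Idl (insert b B))"
  shows "b \<in> saturation R I (Idl B) \<or> (\<exists>g\<in>G. b \<in> saturation R I (Idl (insert g B)))"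
proof (rule disjCI)
  assume no: "\<not> (\<exists>g\<in>G. b \<in> saturation R I (Idl (insert g B)))"
  interpret B: ideal "Idl B" R using B by (rule genideal_ideal)
  \<comment> \<open>The preimage in \<open>R\<close> of the local ideal generated by
    \<open>B\<close> and \<open>I b\<close>, with denominators cleared.\<close>
  let ?X = "{x \<in> carrier R. \<exists>s\<in>carrier R - I. \<exists>r\<in>I. \<exists>y\<in>Idl B. s \<otimes> x = (r \<otimes> b) \<oplus> y}"
  have X: "ideal ?X R"
  proof (rule ideal_criterion)
    show "?X \<subseteq> carrier R" by auto
    show "\<zero> \<in> ?X" using b one_compl
      by (auto intro!: bexI[of _ \<one>] bexI[of _ \<zero>])
    fix x x' assume "x \<in> ?X" "x' \<in> ?X"
    then obtain s r y s' r' y' where *: "x \<in> carrier R" "s \<in> carrier R - I" "r \<in> I" "y \<in> Idl B"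
      "s \<otimes> x = (r \<otimes> b) \<oplus> y" "x' \<in> carrier R" "s' \<in> carrier R - I" "r' \<in> I" "y' \<in> Idl B"
      "s' \<otimes> x' = (r' \<otimes> b) \<oplus> y'" by auto
    have cl: "s \<in> carrier R" "s' \<in> carrier R" "r \<in> carrier R" "r' \<in> carrier R"
      "y \<in> carrier R" "y' \<in> carrier R" using * B.Icarr Icarr by auto
    have "(s \<otimes> s') \<otimes> (x \<oplus> x') = s' \<otimes> (s \<otimes> x) \<oplus> s \<otimes> (s' \<otimes> x')"
      using *(1,6) cl by (simp add: r_distr m_ac)
    also have "\<dots> = ((s' \<otimes> r \<oplus> s \<otimes> r') \<otimes> b) \<oplus> (s' \<otimes> y \<oplus> s \<otimes> y')"
      unfolding *(5,10) using b cl by (simp add: r_distr l_distr m_ac a_ac)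
    finally have "(s \<otimes> s') \<otimes> (x \<oplus> x') = ((s' \<otimes> r \<oplus> s \<otimes> r') \<otimes> b) \<oplus> (s' \<otimes> y \<oplus> s \<otimes> y')" .
    moreover have "s' \<otimes> r \<oplus> s \<otimes> r' \<in> I" "s' \<otimes> y \<oplus> s \<otimes> y' \<in> Idl B"
      using * cl by (auto intro: I_l_closed B.I_l_closed)
    moreover have "s \<otimes> s' \<in> carrier R - I" using * compl_mult by blast
    ultimately show "x \<oplus> x' \<in> ?X" using * by (intro CollectI conjI) blast+
  next
    fix t x assume t: "t \<in> carrier R" and "x \<in> ?X"
    then obtain s r y where *: "x \<in> carrier R" "s \<in> carrier R - I" "r \<in> I" "y \<in> Idl B"
      "s \<otimes> x = (r \<otimes> b) \<oplus> y" by auto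
    have cl: "s \<in> carrier R" "r \<in> carrier R" "y \<in> carrier R" using * B.Icarr Icarr by auto
    have "s \<otimes> (t \<otimes> x) = t \<otimes> (s \<otimes> x)" using *(1) cl t by (simp add: m_ac)
    also have "\<dots> = ((t \<otimes> r) \<otimes> b) \<oplus> (t \<otimes> y)" using * cl t b by (simp add: r_distr m_assoc)
    finally have "s \<otimes> (t \<otimes> x) = ((t \<otimes> r) \<otimes> b) \<oplus> (t \<otimes> y)" .
    moreover have "t \<otimes> r \<in> I" "t \<otimes> y \<in> Idl B" using * t by (auto intro: I_l_closed B.I_l_closed)
    ultimately show "t \<otimes> x \<in> ?X" using *(1,2) t by (intro CollectI conjI) blast+
  qed
  have "G \<subseteq> ?X"
  proof
    fix g assume g: "g \<in> G"
    then have gB: "insert g B \<subseteq> carrier R" using G B by auto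
    interpret gB: ideal "Idl (insert g B)" R using gB by (rule genideal_ideal)
    obtain s where s: "s \<in> carrier R - I" "s \<otimes> g \<in> Idl (insert b B)"
      using g GB by (auto simp: saturation_def)
    then obtain r y where r: "r \<in> carrier R" "y \<in> Idl B" "s \<otimes> g = (r \<otimes> b) \<oplus> y"
      using b B by (elim Idl_insertE[rotated 2]) auto
    \<comment> \<open>A coefficient outside \<open>I\<close> would be a local unit, and the relation
      could be solved for \<open>b\<close> in terms of \<open>g\<close> and
      \<open>B\<close>.\<close>
    have "r \<in> I"
    proof (rule ccontr)
      assume "r \<notin> I"
      have sub: "Idl B \<subseteq> Idl (insert g B)" by (rule subset_Idl_subset[OF gB]) auto
      have "r \<otimes> b = (s \<otimes> g) \<ominus> y" using r b s B.Icarr[OF r(2)] g G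
        by (simp add: r(3) a_minus_def a_assoc r_neg)
      moreover have "s \<otimes> g \<in> Idl (insert g B)" using genideal_self[OF gB] s by (auto intro: gB.I_l_closed)
      moreover have "y \<in> Idl (insert g B)" using r(2) sub by blast
      ultimately have "r \<otimes> b \<in> Idl (insert g B)" by (simp add: a_minus_def)
      then have "b \<in> saturation R I (Idl (insert g B))"
        using b r \<open>r \<notin> I\<close> by (auto simp: saturation_def)
      then show False using no g by blast
    qed
    then show "g \<in> ?X" using g G s r by blast
  qed
  then have "Idl G \<subseteq> ?X" by (rule genideal_minimal[OF X])
  moreover obtain t where t: "t \<in> carrier R - I" "t \<otimes> b \<in> Idl G"
    using b(2) by (auto simp: saturation_def)
  ultimately obtain s r y where *: "s \<in> carrier R - I" "r \<in> I" "y \<in> Idl B"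
    "s \<otimes> (t \<otimes> b) = (r \<otimes> b) \<oplus> y" by blast
  have cl: "s \<in> carrier R" "t \<in> carrier R" "r \<in> carrier R" "y \<in> carrier R"
    using * t B.Icarr Icarr by auto
  \<comment> \<open>Nakayama's trick: the coefficient of \<open>b\<close> is an element outside
    \<open>I\<close> minus an element of \<open>I\<close>, hence again outside
    \<open>I\<close>.\<close>
  have "((s \<otimes> t) \<ominus> r) \<otimes> b = s \<otimes> (t \<otimes> b) \<ominus> r \<otimes> b"
    using b cl by (simp add: a_minus_def l_distr l_minus m_assoc)
  also have "\<dots> = y" unfolding *(4) using b cl by (simp add: a_minus_def a_ac r_neg)
  finally have "((s \<otimes> t) \<ominus> r) \<otimes> b \<in> Idl B" using * by simp
  moreover have "(s \<otimes> t) \<ominus> r \<notin> I"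
  proof
    assume "(s \<otimes> t) \<ominus> r \<in> I"
    then have "((s \<otimes> t) \<ominus> r) \<oplus> r \<in> I" using * by auto
    then have "s \<otimes> t \<in> I" using cl by (simp add: a_minus_def a_assoc l_neg)
    then show False using * t compl_mult by blast
  qed
  ultimately show "b \<in> saturation R I (Idl B)" using b cl by (auto simp: saturation_def)
qed

text \<open>Steinitz exchange over the local ring at \<open>I\<close>.\<close>

lemma (in primeideal) generators_among:
  assumes "finite B" "B \<subseteq> carrier R" "G \<subseteq> carrier R"
    and "B \<subseteq> saturation R I (Idl G)" "G \<subseteq> saturation R I (Idl B)"
  obtains E where "finite E" "E \<subseteq> G" "card E \<le> card B" "G \<subseteq> saturation R I (Idl E)"
  using assms
\<comment> \<open>The measure counts the generators that are not yet taken from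
  \<open>G\<close>.\<close>
proof (induct "card (B - G)" arbitrary: B thesis rule: less_induct)
  case less
  show ?case
  proof (cases "B \<subseteq> G")
    case True
    then show ?thesis using less.prems by blast
  next
    case False
    then obtain b where b: "b \<in> B" "b \<notin> G" by blast
    define B0 where "B0 = B - {b}"
    have B: "B = insert b B0" "finite B0" "b \<notin> B0" using b less.prems(2) by (auto simp: B0_def)
    \<comment> \<open>\<open>B'\<close> is either \<open>B0\<close> or \<open>B0\<close> with one
      element of \<open>G\<close> added. It loses \<open>b\<close> and gains nothing outside
      \<open>G\<close>, so the measure drops.\<close>
    have key: thesis if B': "b \<in> saturation R I (Idl B')" "B0 \<subseteq> B'" "B' - B0 \<subseteq> G" "finite B'"
      "card B' \<le> card B" for B'
    proof -
      have B'R: "B' \<subseteq> carrier R" using B' less.prems(3,4) B by auto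
      have "B' - G \<subset> B - G" using B' B b by auto
      then have lt: "card (B' - G) < card (B - G)"
        using less.prems(2) by (intro psubset_card_mono) auto
      have id: "ideal (Idl B') R" using B'R by (rule genideal_ideal)
      have sub: "B' \<subseteq> saturation R I (Idl B')"
        using genideal_self[OF B'R] subset_saturation[of "Idl B'"] ideal.Icarr[OF id] by blast
      have "G \<subseteq> saturation R I (Idl B')"
        using less.prems(6) Idl_subset_saturation[OF _ id, of B] B' B sub by auto
      moreover have "B' \<subseteq> saturation R I (Idl G)"
      proof -
        have "ideal (Idl G) R" using less.prems(4) by (rule genideal_ideal)
        then have "G \<subseteq> saturation R I (Idl G)"
          using genideal_self[OF less.prems(4)] subset_saturation[of "Idl G"]
          by (meson ideal.Icarr order_trans subsetI)
        then show ?thesis using less.prems(5) B' B by blast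
      qed
      ultimately obtain E where "finite E" "E \<subseteq> G" "card E \<le> card B'" "G \<subseteq> saturation R I (Idl E)"
        using less.hyps[OF lt _ B'(4) B'R less.prems(4)] by blast
      then show thesis using less.prems(1) B'(5) by auto
    qed
    have "b \<in> saturation R I (Idl B0) \<or> (\<exists>g\<in>G. b \<in> saturation R I (Idl (insert g B0)))"
      using less.prems b B by (intro exchange_or_drop) auto
    then show ?thesis
    proof (elim disjE bexE)
      assume "b \<in> saturation R I (Idl B0)"
      then show ?thesis using key[of B0] B by auto
    next
      fix g assume "g \<in> G" "b \<in> saturation R I (Idl (insert g B0))"
      moreover have "card (insert g B0) \<le> card B" using B by (simp add: card_insert_if)
      ultimately show ?thesis using key[of "insert g B0"] B by blast
    qed
  qed
qed

section \<open>Polynomials with coefficients in an ideal\<close>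

context cring
begin

section \<open>Linear systems that are triangular modulo a prime\<close>

lemma ideal_finsum_closed:
  assumes "ideal I R" "finite A" "\<And>a. a \<in> A \<Longrightarrow> f a \<in> I"
  shows "(\<Oplus>a\<in>A. f a) \<in> I"
  using assms(2,3)
proof (induct A rule: finite_induct)
  interpret I: ideal I R by fact
  case empty
  then show ?case by simp
next
  interpret I: ideal I R by fact
  case (insert a A)
  then have "f \<in> A \<rightarrow> carrier R" "f a \<in> carrier R" using I.Icarr by auto
  then show ?case using insert by simp
qed

text \<open>Locally at \<open>M\<close> the determinant is a unit, being congruent modulo
  \<open>M\<close> to the product of the diagonal. The proof eliminates the last unknown without
  division, so that only the cancellation \<open>sat\<close> is required.\<close>

lemma triangular_mem:
  fixes r :: nat
  assumes "primeideal M R" "ideal I R"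
    and sat: "\<And>s x. s \<in> carrier R - M \<Longrightarrow> x \<in> carrier R \<Longrightarrow> s \<otimes> x \<in> I \<Longrightarrow> x \<in> I"
    and x: "\<And>q. q < r \<Longrightarrow> x q \<in> carrier R"
    and A: "\<And>p q. p < r \<Longrightarrow> q < r \<Longrightarrow> A p q \<in> carrier R"
    and diag: "\<And>p. p < r \<Longrightarrow> A p p \<notin> M"
    and upper: "\<And>p q. p < q \<Longrightarrow> q < r \<Longrightarrow> A p q \<in> M"
    and rel: "\<And>p. p < r \<Longrightarrow> (\<Oplus>q\<in>{..<r}. A p q \<otimes> x q) \<in> I"
    and q: "q < r"
  shows "x q \<in> I"
  using x A diag upper rel q
proof (induct r arbitrary: A q)
  case 0
  then show ?case by simp
next
  case (Suc r)
  interpret M: primeideal M R by fact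
  interpret I: ideal I R by fact
  note x = Suc.prems(1) and A = Suc.prems(2) and diag = Suc.prems(3) and upper = Suc.prems(4)
    and rel = Suc.prems(5)
  let ?a = "A r r"
  \<comment> \<open>Row \<open>p\<close> is scaled by the pivot, and \<open>A p r\<close> times the
    last row is subtracted. As \<open>A p r\<close> lies in \<open>M\<close>, modulo
    \<open>M\<close> the row is only scaled, and the shape of the matrix persists.\<close>
  define A' where "A' = (\<lambda>p q. ?a \<otimes> A p q \<oplus> (\<ominus> A p r) \<otimes> A r q)"
  define S where "S = (\<lambda>p. \<Oplus>q\<in>{..<r}. A p q \<otimes> x q)"
  have S: "S p \<in> carrier R" if "p \<le> r" for p
    unfolding S_def using x A that by (intro finsum_closed) auto
  have rel': "A p r \<otimes> x r \<oplus> S p \<in> I" if "p \<le> r" for p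
  proof -
    have "(\<Oplus>q\<in>{..<Suc r}. A p q \<otimes> x q) = A p r \<otimes> x r \<oplus> S p"
      unfolding S_def lessThan_Suc using x A that by (subst finsum_insert) auto
    then show ?thesis using rel[of p] that by simp
  qed
  have small: "x q \<in> I" if "q < r" for q
  proof (rule Suc.hyps[of A'])
    fix p assume p: "p < r"
    have cl: "A p r \<in> carrier R" "?a \<in> carrier R" "x r \<in> carrier R" "S p \<in> carrier R" "S r \<in> carrier R"
      using A x S p by auto
    have "(\<Oplus>q\<in>{..<r}. A' p q \<otimes> x q)
        = (\<Oplus>q\<in>{..<r}. ?a \<otimes> (A p q \<otimes> x q) \<oplus> (\<ominus> A p r) \<otimes> (A r q \<otimes> x q))"
      unfolding A'_def using A x p by (intro finsum_cong') (auto simp: l_distr m_assoc)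
    also have "\<dots> = (\<Oplus>q\<in>{..<r}. ?a \<otimes> (A p q \<otimes> x q)) \<oplus> (\<Oplus>q\<in>{..<r}. (\<ominus> A p r) \<otimes> (A r q \<otimes> x q))"
      using A x p by (intro finsum_addf) auto
    also have "\<dots> = ?a \<otimes> S p \<oplus> (\<ominus> A p r) \<otimes> S r"
      unfolding S_def using A x p by (subst (1 2) finsum_rdistr) auto
    also have "\<dots> = ?a \<otimes> (A p r \<otimes> x r \<oplus> S p) \<oplus> (\<ominus> A p r) \<otimes> (?a \<otimes> x r \<oplus> S r)"
      using cl by algebra
    also have "\<dots> \<in> I" using rel'[of p] rel'[of r] p cl by (auto intro: I.I_l_closed)
    finally show "(\<Oplus>q\<in>{..<r}. A' p q \<otimes> x q) \<in> I" .
    show "A' p p \<notin> M"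
    proof
      assume "A' p p \<in> M"
      moreover have "A p r \<in> M" using upper p by simp
      ultimately have "A' p p \<oplus> A r p \<otimes> A p r \<in> M"
        using A[of r p] p by (simp add: M.a_closed M.I_l_closed)
      also have "A' p p \<oplus> A r p \<otimes> A p r = ?a \<otimes> A p p"
      proof -
        have "A p p \<in> carrier R" "A r p \<in> carrier R" using A p by auto
        then show ?thesis unfolding A'_def using cl by algebra
      qed
      finally show False using M.I_prime[of ?a "A p p"] A[of p p] cl diag[of p] diag[of r] p by auto
    qed
    show "A' p q \<in> carrier R" if "q < r" for q
      unfolding A'_def using A p that by simp
  next
    fix p q assume pq: "p < q" "q < r"
    have "?a \<otimes> A p q \<in> M" using A upper[of p q] pq by (simp add: M.I_l_closed)
    moreover have "(\<ominus> A p r) \<otimes> A r q \<in> M" using A upper[of p r] pq by (simp add: M.I_r_closed)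
    ultimately show "A' p q \<in> M" unfolding A'_def by simp
  qed (use x that in auto)
  show ?case
  proof (cases "q = r")
    case True
    \<comment> \<open>Back substitution: with the other unknowns in \<open>I\<close>, the last row
      leaves only \<open>?a\<close> times \<open>x r\<close>.\<close>
    have "S r \<in> I" unfolding S_def
      using small A by (intro ideal_finsum_closed I.is_ideal) (auto intro: I.I_l_closed)
    then have "(?a \<otimes> x r \<oplus> S r) \<ominus> S r \<in> I" using rel'[of r] by (simp add: a_minus_def)
    moreover have "(?a \<otimes> x r \<oplus> S r) \<ominus> S r = ?a \<otimes> x r"
      using S[of r] A[of r r] x[of r] by (simp add: a_minus_def a_assoc r_neg)
    ultimately have "?a \<otimes> x r \<in> I" by simp
    then show ?thesis using sat[of ?a "x r"] A[of r r] x[of r] diag[of r] True by simp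
  next
    case False
    then show ?thesis using small Suc.prems(6) by simp
  qed
qed

lemma set_add_upper:
  assumes "ideal I R" "ideal J R"
  shows "I \<subseteq> I <+>\<^bsub>R\<^esub> J" "J \<subseteq> I <+>\<^bsub>R\<^esub> J"
proof -
  have "I \<union> J \<subseteq> carrier R"
    using ideal.Icarr[OF assms(1)] ideal.Icarr[OF assms(2)] by blast
  then show "I \<subseteq> I <+>\<^bsub>R\<^esub> J" "J \<subseteq> I <+>\<^bsub>R\<^esub> J"
    using genideal_self[of "I \<union> J"] union_genideal[OF assms] by auto
qed

lemma set_add_least:
  assumes "ideal K R" "I \<subseteq> K" "J \<subseteq> K"
  shows "I <+>\<^bsub>R\<^esub> J \<subseteq> K"
proof -
  interpret K: ideal K R by fact
  show ?thesis using assms unfolding set_add_def' by auto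
qed

end

section \<open>Polynomials over an ideal and their contents\<close>

context UP_cring
begin

text \<open>This is \<open>I[t]\<close>. For an ideal \<open>I\<close>, a polynomial lies in it
  exactly when its content lies in \<open>I\<close>.\<close>

definition poly_ideal :: "'a set \<Rightarrow> (nat \<Rightarrow> 'a) set" where
  "poly_ideal I = {p \<in> carrier P. \<forall>n. coeff P p n \<in> I}"

lemma poly_ideal_ideal:
  assumes "ideal I R"
  shows "ideal (poly_ideal I) P"
proof -
  interpret I: ideal I R by fact
  show ?thesis
    by (rule P.ideal_criterion)
      (auto simp: poly_ideal_def intro!: R.ideal_finsum_closed[OF assms] I.I_l_closed)
qed

lemma poly_ideal_mult:
  assumes "ideal I R" "ideal J R" "p \<in> poly_ideal I" "q \<in> poly_ideal J"
  shows "p \<otimes>\<^bsub>P\<^esub> q \<in> poly_ideal (I \<cdot>\<^bsub>R\<^esub> J)"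
  using assms(3,4)
  by (auto simp: poly_ideal_def intro!: R.ideal_finsum_closed R.ideal_prod_is_ideal assms ideal_prod.prod)

lemma poly_ideal_mono: "I \<subseteq> J \<Longrightarrow> poly_ideal I \<subseteq> poly_ideal J"
  by (auto simp: poly_ideal_def)

lemma content_ideal: "f \<in> carrier P \<Longrightarrow> ideal (content R f) R"
  unfolding content_def P_def[symmetric] by (intro R.genideal_ideal) auto

lemma coeff_mem_content: "f \<in> carrier P \<Longrightarrow> coeff P f n \<in> content R f"
  unfolding content_def P_def[symmetric] by (rule subsetD[OF R.genideal_self]) auto

lemma mem_poly_ideal_content: "f \<in> carrier P \<Longrightarrow> f \<in> poly_ideal (content R f)"
  by (simp add: poly_ideal_def coeff_mem_content)

lemma content_subset: "ideal I R \<Longrightarrow> f \<in> poly_ideal I \<Longrightarrow> content R f \<subseteq> I"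
  unfolding content_def P_def[symmetric] by (rule R.genideal_minimal) (auto simp: poly_ideal_def)

lemma content_mult_subset:
  assumes "f \<in> carrier P" "g \<in> carrier P"
  shows "content R (f \<otimes>\<^bsub>P\<^esub> g) \<subseteq> content R f \<cdot>\<^bsub>R\<^esub> content R g"
  using assms by (intro content_subset poly_ideal_mult R.ideal_prod_is_ideal content_ideal mem_poly_ideal_content)

lemma coeff_eventually_zero:
  assumes "p \<in> carrier P"
  obtains N where "\<And>n. N \<le> n \<Longrightarrow> coeff P p n = \<zero>"
  using assms deg_aboveD[of p] by (metis Suc_le_eq)

text \<open>Gauss' lemma over the localization at \<open>M\<close>: the coefficient of \<open>D\<close> of least degree
  outside \<open>M\<close> makes the equations for the coefficients of \<open>F\<close> triangular modulo \<open>M\<close>.\<close>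

lemma poly_ideal_cancel:
  assumes M: "primeideal M R" and I: "ideal I R"
    and sat: "\<And>s x. s \<in> carrier R - M \<Longrightarrow> x \<in> carrier R \<Longrightarrow> s \<otimes> x \<in> I \<Longrightarrow> x \<in> I"
    and F: "F \<in> carrier P" and D: "D \<in> carrier P" "D \<notin> poly_ideal M"
    and FD: "F \<otimes>\<^bsub>P\<^esub> D \<in> poly_ideal I"
  shows "F \<in> poly_ideal I"
proof -
  interpret I: ideal I R by fact
  define n where "n = (LEAST n. coeff P D n \<notin> M)"
  have "\<exists>n. coeff P D n \<notin> M" using D by (auto simp: poly_ideal_def)
  then have n: "coeff P D n \<notin> M" "\<And>i. i < n \<Longrightarrow> coeff P D i \<in> M"
    unfolding n_def by (rule LeastI_ex) (use not_less_Least in blast)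
  obtain r where r: "\<And>q. r \<le> q \<Longrightarrow> coeff P F q = \<zero>" using coeff_eventually_zero[OF F] by blast
  \<comment> \<open>Row \<open>p\<close> expresses the coefficient of \<open>F D\<close> at
    \<open>p + n\<close>. The diagonal entries are the coefficient of \<open>D\<close> at
    \<open>n\<close>; for \<open>p < q\<close> the exponent falls below \<open>n\<close>. The
    condition guards against truncated subtraction.\<close>
  define A where "A = (\<lambda>p q. if q \<le> p + n then coeff P D (p + n - q) else \<zero>)"
  have "coeff P F q \<in> I" for q
  proof (cases "q < r")
    case True
    show ?thesis
    proof (rule R.triangular_mem[OF M I sat, where r = r and A = A and q = q and x = "coeff P F"])
      fix p assume p: "p < r"
      have "(\<Oplus>q\<in>{..<r}. A p q \<otimes> coeff P F q) = (\<Oplus>q\<in>{..p + n}. coeff P F q \<otimes> coeff P D (p + n - q))"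
        using F D r by (intro R.add.finprod_mono_neutral_cong) (auto simp: A_def R.m_comm)
      also have "\<dots> = coeff P (F \<otimes>\<^bsub>P\<^esub> D) (p + n)" using F D by simp
      finally show "(\<Oplus>q\<in>{..<r}. A p q \<otimes> coeff P F q) \<in> I" using FD by (simp add: poly_ideal_def)
      show "A p p \<notin> M" using n by (simp add: A_def)
      show "A p q \<in> carrier R" for q using D by (simp add: A_def)
    next
      interpret M: primeideal M R by fact
      fix p q assume "p < q" "q < r"
      then show "A p q \<in> M" using n(2)[of "p + n - q"] by (auto simp: A_def)
    qed (use F True in auto)
  next
    case False
    then show ?thesis using r by simp
  qed
  then show ?thesis using F by (simp add: poly_ideal_def)
qed

text \<open>The cancellation lemma with \<open>M\<close> itself as the ideal; primality of
  \<open>M\<close> provides its hypothesis \<open>sat\<close>.\<close>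

lemma poly_ideal_prime_mult:
  assumes M: "primeideal M R" and "p \<in> carrier P" "q \<in> carrier P" "p \<notin> poly_ideal M" "q \<notin> poly_ideal M"
  shows "p \<otimes>\<^bsub>P\<^esub> q \<notin> poly_ideal M"
  using poly_ideal_cancel[OF M primeideal.axioms(1)[OF M], of p q] primeideal.I_prime[OF M] assms(2-)
  by blast

section \<open>Kronecker substitution\<close>

text \<open>The polynomial \<open>f(t^m)\<close>.\<close>

definition stretch :: "nat \<Rightarrow> (nat \<Rightarrow> 'a) \<Rightarrow> nat \<Rightarrow> 'a" where
  "stretch m f = (\<lambda>n. if m dvd n then coeff P f (n div m) else \<zero>)"

lemma stretch_closed [simp]:
  assumes "0 < m" "f \<in> carrier P"
  shows "stretch m f \<in> carrier P"
proof -
  obtain N where N: "\<And>n. N \<le> n \<Longrightarrow> coeff P f n = \<zero>" using coeff_eventually_zero[OF assms(2)] by blast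
  have "stretch m f n = \<zero>" if "N * m < n" for n
    using that N[of "n div m"] assms(1) by (auto simp: stretch_def elim!: dvdE)
  then show ?thesis
    using assms by (auto simp: P_def UP_def stretch_def intro!: mem_upI bound.intro)
qed

lemma coeff_stretch [simp]:
  assumes "0 < m" "f \<in> carrier P"
  shows "coeff P (stretch m f) n = (if m dvd n then coeff P f (n div m) else \<zero>)"
proof -
  have "stretch m f \<in> up R" using stretch_closed[OF assms] by (simp add: P_def UP_def)
  then have "coeff P (stretch m f) n = stretch m f n" by (simp add: P_def UP_def)
  then show ?thesis by (simp add: stretch_def)
qed

lemma stretch_mem_poly_ideal:
  assumes "0 < m" "ideal I R" "f \<in> poly_ideal I"
  shows "stretch m f \<in> poly_ideal I"
proof -
  interpret I: ideal I R by fact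
  show ?thesis using assms by (auto simp: poly_ideal_def)
qed

text \<open>Only multiples of \<open>m\<close> contribute to the convolution on the right. If
  \<open>m\<close> does not divide \<open>n\<close>, it cannot divide both \<open>i\<close> and
  \<open>n - i\<close>.\<close>

lemma stretch_mult:
  assumes m: "0 < m" and f: "f \<in> carrier P" and g: "g \<in> carrier P"
  shows "stretch m (f \<otimes>\<^bsub>P\<^esub> g) = stretch m f \<otimes>\<^bsub>P\<^esub> stretch m g"
proof (rule up_eqI)
  fix n
  show "coeff P (stretch m (f \<otimes>\<^bsub>P\<^esub> g)) n = coeff P (stretch m f \<otimes>\<^bsub>P\<^esub> stretch m g) n"
  proof (cases "m dvd n")
    case True
    then obtain q where q: "n = m * q" by blast
    let ?t = "\<lambda>i. coeff P (stretch m f) i \<otimes> coeff P (stretch m g) (n - i)"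
    have "(\<Oplus>i\<in>{..n}. ?t i) = (\<Oplus>i\<in>(*) m ` {..q}. ?t i)"
    proof (rule R.add.finprod_mono_neutral_cong_right)
      show "(*) m ` {..q} \<subseteq> {..n}" using q by auto
      fix i assume "i \<in> {..n} - (*) m ` {..q}"
      then have "\<not> m dvd i" using m q by auto
      then show "?t i = \<zero>" using m f g by simp
    qed (use m f g in auto)
    also have "\<dots> = (\<Oplus>i\<in>{..q}. ?t (m * i))"
      using m f g by (intro R.finsum_reindex) (auto simp: inj_on_def)
    also have "\<dots> = (\<Oplus>i\<in>{..q}. coeff P f i \<otimes> coeff P g (q - i))"
      using m f g by (intro R.finsum_cong') (auto simp: q simp flip: diff_mult_distrib2)
    finally show ?thesis using m f g q by simp
  next
    case False
    have "(\<Oplus>i\<in>{..n}. coeff P (stretch m f) i \<otimes> coeff P (stretch m g) (n - i)) = \<zero>"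
    proof (rule R.add.finprod_one_eqI)
      fix i assume "i \<in> {..n}"
      then have "\<not> (m dvd i \<and> m dvd (n - i))" using False by (metis atMost_iff dvd_diffD)
      then show "coeff P (stretch m f) i \<otimes> coeff P (stretch m g) (n - i) = \<zero>"
        using m f g by auto
    qed
    then show ?thesis using False m f g by simp
  qed
qed (use assms in auto)

text \<open>Since the degree of \<open>p\<close> is below \<open>m\<close>, division with remainder
  leaves a single term in the convolution. Thus \<open>t\<close> and \<open>t^m\<close> behave like
  independent variables.\<close>

lemma coeff_mult_stretch:
  assumes p: "p \<in> carrier P" "deg R p < m" and f: "f \<in> carrier P" and r: "r < m"
  shows "coeff P (p \<otimes>\<^bsub>P\<^esub> stretch m f) (m * q + r) = coeff P p r \<otimes> coeff P f q"
proof -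
  have m: "0 < m" using r by simp
  let ?n = "m * q + r"
  let ?t = "\<lambda>i. coeff P p i \<otimes> coeff P (stretch m f) (?n - i)"
  have "(\<Oplus>i\<in>{..?n}. ?t i) = (\<Oplus>i\<in>{r}. ?t i)"
  proof (rule R.add.finprod_mono_neutral_cong_right)
    fix i assume i: "i \<in> {..?n} - {r}"
    show "?t i = \<zero>"
    proof (cases "i < m")
      case True
      have "\<not> m dvd (?n - i)"
      proof
        assume "m dvd (?n - i)"
        then have "?n mod m = i mod m" using i by (metis DiffD1 atMost_iff mod_eq_dvd_iff_nat)
        then show False using True r i by simp
      qed
      then show ?thesis using m p f by simp
    next
      case False
      then show ?thesis using deg_aboveD[OF _ p(1), of i] p m f by simp
    qed
  qed (use m p f in auto)
  also have "\<dots> = coeff P p r \<otimes> coeff P f q" using m p f by simp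
  finally show ?thesis using m p f by simp
qed

end

section \<open>Elimination\<close>

context UP_cring
begin

text \<open>A row \<open>w\<close> evaluated at the constants \<open>b i\<close>. The elimination
  acts on rows of polynomials and not on their values, because the \<open>b i\<close> may satisfy
  relations.\<close>

definition comb :: "nat \<Rightarrow> (nat \<Rightarrow> 'a) \<Rightarrow> (nat \<Rightarrow> nat \<Rightarrow> 'a) \<Rightarrow> nat \<Rightarrow> 'a" where
  "comb k b w = (\<Oplus>\<^bsub>P\<^esub>i\<in>{..<k}. w i \<otimes>\<^bsub>P\<^esub> monom P (b i) 0)"

lemma comb_closed [simp]:
  assumes "\<And>i. i < k \<Longrightarrow> b i \<in> carrier R" "\<And>i. w i \<in> carrier P"
  shows "comb k b w \<in> carrier P"
  unfolding comb_def using assms by (intro P.finsum_closed) auto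

lemma comb_add:
  assumes "\<And>i. i < k \<Longrightarrow> b i \<in> carrier R" "\<And>i. w i \<in> carrier P" "\<And>i. v i \<in> carrier P"
  shows "comb k b (\<lambda>i. w i \<oplus>\<^bsub>P\<^esub> v i) = comb k b w \<oplus>\<^bsub>P\<^esub> comb k b v"
proof -
  have "comb k b (\<lambda>i. w i \<oplus>\<^bsub>P\<^esub> v i)
      = (\<Oplus>\<^bsub>P\<^esub>i\<in>{..<k}. w i \<otimes>\<^bsub>P\<^esub> monom P (b i) 0 \<oplus>\<^bsub>P\<^esub> v i \<otimes>\<^bsub>P\<^esub> monom P (b i) 0)"
    unfolding comb_def using assms by (intro P.finsum_cong') (auto simp: P.l_distr)
  then show ?thesis unfolding comb_def using assms by (simp add: P.finsum_addf)
qed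

lemma comb_scale:
  assumes "\<And>i. i < k \<Longrightarrow> b i \<in> carrier R" "\<And>i. w i \<in> carrier P" "p \<in> carrier P"
  shows "comb k b (\<lambda>i. p \<otimes>\<^bsub>P\<^esub> w i) = p \<otimes>\<^bsub>P\<^esub> comb k b w"
proof -
  have "comb k b (\<lambda>i. p \<otimes>\<^bsub>P\<^esub> w i)
      = (\<Oplus>\<^bsub>P\<^esub>i\<in>{..<k}. p \<otimes>\<^bsub>P\<^esub> (w i \<otimes>\<^bsub>P\<^esub> monom P (b i) 0))"
    unfolding comb_def using assms by (intro P.finsum_cong') (auto simp: P.m_assoc)
  then show ?thesis unfolding comb_def using assms by (subst P.finsum_rdistr) auto
qed

lemma comb_finsum:
  assumes b: "\<And>i. i < k \<Longrightarrow> b i \<in> carrier R" and "finite A"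
    and "\<And>j. p j \<in> carrier P" "\<And>j i. W j i \<in> carrier P"
  shows "comb k b (\<lambda>i. \<Oplus>\<^bsub>P\<^esub>j\<in>A. p j \<otimes>\<^bsub>P\<^esub> W j i) = (\<Oplus>\<^bsub>P\<^esub>j\<in>A. p j \<otimes>\<^bsub>P\<^esub> comb k b (W j))"
  using assms(2)
proof (induct A rule: finite_induct)
  case empty
  show ?case unfolding comb_def P.finsum_empty using b by (intro P.add.finprod_one_eqI) auto
next
  case (insert a A)
  have "comb k b (\<lambda>i. \<Oplus>\<^bsub>P\<^esub>j\<in>insert a A. p j \<otimes>\<^bsub>P\<^esub> W j i)
      = comb k b (\<lambda>i. p a \<otimes>\<^bsub>P\<^esub> W a i \<oplus>\<^bsub>P\<^esub> (\<Oplus>\<^bsub>P\<^esub>j\<in>A. p j \<otimes>\<^bsub>P\<^esub> W j i))"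
    using insert(1,2) assms(3,4) by (simp add: P.finsum_insert)
  also have "\<dots> = p a \<otimes>\<^bsub>P\<^esub> comb k b (W a) \<oplus>\<^bsub>P\<^esub> (\<Oplus>\<^bsub>P\<^esub>j\<in>A. p j \<otimes>\<^bsub>P\<^esub> comb k b (W j))"
    using assms insert by (simp add: comb_add comb_scale)
  also have "\<dots> = (\<Oplus>\<^bsub>P\<^esub>j\<in>insert a A. p j \<otimes>\<^bsub>P\<^esub> comb k b (W j))"
    using assms insert by (subst P.finsum_insert) auto
  finally show ?case .
qed

lemma coeff_comb:
  assumes "\<And>i. i < k \<Longrightarrow> b i \<in> carrier R" "\<And>i. w i \<in> carrier P"
  shows "coeff P (comb k b w) n = (\<Oplus>i\<in>{..<k}. coeff P (w i) n \<otimes> b i)"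
proof -
  have "coeff P (w i \<otimes>\<^bsub>P\<^esub> monom P (b i) 0) n = coeff P (w i) n \<otimes> b i" if "i < k" for i
    using assms that
    by (simp add: monom_mult_is_smult P.m_comm[of "w i"] R.m_comm del: coeff_mult)
  then show ?thesis unfolding comb_def using assms
    by (subst coeff_finsum) (auto intro!: R.finsum_cong')
qed

lemma comb_diagonal:
  assumes "\<And>i. i < k \<Longrightarrow> b i \<in> carrier R" "D \<in> carrier P" "j < k"
  shows "comb k b (\<lambda>i. if i = j then D else \<zero>\<^bsub>P\<^esub>) = D \<otimes>\<^bsub>P\<^esub> monom P (b j) 0"
proof -
  have "comb k b (\<lambda>i. if i = j then D else \<zero>\<^bsub>P\<^esub>)
      = (\<Oplus>\<^bsub>P\<^esub>i\<in>{..<k}. if j = i then D \<otimes>\<^bsub>P\<^esub> monom P (b i) 0 else \<zero>\<^bsub>P\<^esub>)"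
    unfolding comb_def using assms by (intro P.finsum_cong') auto
  also have "\<dots> = D \<otimes>\<^bsub>P\<^esub> monom P (b j) 0"
    using assms by (intro P.finsum_singleton) auto
  finally show ?thesis .
qed

text \<open>The vectors \<open>W j\<close> are the rows of a partially eliminated system: \<open>F (\<Sum>i. W j i b i)\<close> has
  coefficients in \<open>N\<close>. The new variable \<open>t^m\<close> is independent of the old ones because \<open>m\<close> exceeds all
  degrees in sight. The relation for \<open>g(t^m)\<close>, reduced by the previous rows, is the row \<open>z\<close>. Its pivot
  \<open>z l\<close> is not in \<open>M[t]\<close>: the part in which \<open>t^m\<close> has exponent \<open>e l\<close> is \<open>s D\<close>.\<close>

lemma elimination_step:
  assumes M: "primeideal M R" and C: "ideal C R" and N: "ideal N R"
    and f: "f \<in> carrier P" and g: "g \<in> carrier P" and lk: "l < k"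
    and b: "\<And>j. j < k \<Longrightarrow> b j \<in> carrier R"
    and s: "s \<in> carrier R - M" and u: "\<And>j. u j \<in> carrier P"
    and sg: "\<And>n. s \<otimes> coeff P g n = (\<Oplus>j\<in>{..<k}. coeff P (u j) n \<otimes> b j)"
    and e: "\<And>i j. i < k \<Longrightarrow> j < k \<Longrightarrow> coeff P (u j) (e i) = (if i = j then s else \<zero>)"
    and F: "F \<in> carrier P" "content R F = C" and D: "D \<in> carrier P" "D \<notin> poly_ideal M"
    and W: "\<And>j i. W j i \<in> carrier P"
    and diag: "\<And>j i. j < l \<Longrightarrow> i < l \<Longrightarrow> W j i = (if i = j then D else \<zero>\<^bsub>P\<^esub>)"
    and rel: "\<And>j. j < l \<Longrightarrow> F \<otimes>\<^bsub>P\<^esub> comb k b (W j) \<in> poly_ideal N"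
  shows "\<exists>F' D' W'. F' \<in> carrier P \<and> content R F' = C \<cdot>\<^bsub>R\<^esub> content R f
    \<and> D' \<in> carrier P \<and> D' \<notin> poly_ideal M \<and> (\<forall>j i. W' j i \<in> carrier P)
    \<and> (\<forall>j<Suc l. \<forall>i<Suc l. W' j i = (if i = j then D' else \<zero>\<^bsub>P\<^esub>))
    \<and> (\<forall>j<Suc l. F' \<otimes>\<^bsub>P\<^esub> comb k b (W' j)
        \<in> poly_ideal (N \<cdot>\<^bsub>R\<^esub> content R f <+>\<^bsub>R\<^esub> C \<cdot>\<^bsub>R\<^esub> content R (f \<otimes>\<^bsub>P\<^esub> g)))"
proof -
  interpret M: primeideal M R by fact
  \<comment> \<open>The bound on \<open>F\<close> separates the coefficients of
    \<open>F f(t^m)\<close>; the bounds on \<open>D\<close> and on column \<open>l\<close> of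
    \<open>W\<close> isolate one coefficient of the pivot.\<close>
  define m where "m = Suc (deg R F + deg R D + (\<Sum>j<l. deg R (W j l)))"
  have m: "0 < m" "deg R F < m" "deg R D < m" by (auto simp: m_def)
  have mW: "deg R (W j l) < m" if "j < l" for j
  proof -
    have "deg R (W j l) \<le> (\<Sum>j<l. deg R (W j l))" using that by (intro member_le_sum) auto
    then show ?thesis by (simp add: m_def)
  qed
  let ?f = "stretch m f" and ?u = "\<lambda>j. stretch m (u j)" and ?g = "stretch m g"
  let ?N1 = "N \<cdot>\<^bsub>R\<^esub> content R f" and ?N2 = "C \<cdot>\<^bsub>R\<^esub> content R (f \<otimes>\<^bsub>P\<^esub> g)"
  define N' where "N' = ?N1 <+>\<^bsub>R\<^esub> ?N2"
  have cf: "ideal (content R f) R" "ideal (content R (f \<otimes>\<^bsub>P\<^esub> g)) R"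
    using f g by (auto intro: content_ideal)
  have N12: "ideal ?N1 R" "ideal ?N2 R" using C N cf by (auto intro: R.ideal_prod_is_ideal)
  then have N': "ideal N' R" unfolding N'_def by (rule R.add_ideals)
  interpret K: ideal "poly_ideal N'" P by (rule poly_ideal_ideal[OF N'])
  have sub: "poly_ideal ?N1 \<subseteq> poly_ideal N'" "poly_ideal ?N2 \<subseteq> poly_ideal N'"
    unfolding N'_def using R.set_add_upper[OF N12] by (auto intro!: poly_ideal_mono)
  have cl [simp]: "?f \<in> carrier P" "?g \<in> carrier P" "?u j \<in> carrier P" "monom P s 0 \<in> carrier P"
    for j using m f g u s by auto
  define H where "H = F \<otimes>\<^bsub>P\<^esub> ?f"
  have H [simp]: "H \<in> carrier P" using F by (simp add: H_def)

  have relH: "H \<otimes>\<^bsub>P\<^esub> comb k b (W j) \<in> poly_ideal N'" if "j < l" for j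
  proof -
    have "(F \<otimes>\<^bsub>P\<^esub> comb k b (W j)) \<otimes>\<^bsub>P\<^esub> ?f \<in> poly_ideal ?N1"
      using rel[OF that] N cf m f by (intro poly_ideal_mult stretch_mem_poly_ideal mem_poly_ideal_content)
    moreover have "(F \<otimes>\<^bsub>P\<^esub> comb k b (W j)) \<otimes>\<^bsub>P\<^esub> ?f = H \<otimes>\<^bsub>P\<^esub> comb k b (W j)"
      unfolding H_def using F W b by (simp add: P.m_ac)
    ultimately show ?thesis using sub by auto
  qed

  \<comment> \<open>In the first \<open>l\<close> columns \<open>W\<close> is \<open>D\<close> times
    the identity, so subtracting \<open>y\<close> from the scaled row of the \<open>u i(t^m)\<close>
    makes these columns vanish. The sign is a factor so that \<open>comb_scale\<close>
    applies.\<close>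
  define y where "y = (\<lambda>i. \<Oplus>\<^bsub>P\<^esub>j\<in>{..<l}. ?u j \<otimes>\<^bsub>P\<^esub> W j i)"
  define z where "z = (\<lambda>i. D \<otimes>\<^bsub>P\<^esub> ?u i \<oplus>\<^bsub>P\<^esub> (\<ominus>\<^bsub>P\<^esub> \<one>\<^bsub>P\<^esub>) \<otimes>\<^bsub>P\<^esub> y i)"
  have y: "y i \<in> carrier P" for i unfolding y_def using W by (intro P.finsum_closed) auto
  have z: "z i \<in> carrier P" for i unfolding z_def using y D by simp

  have comb_u: "comb k b ?u = monom P s 0 \<otimes>\<^bsub>P\<^esub> ?g"
  proof (rule up_eqI)
    fix n
    have "(\<Oplus>i\<in>{..<k}. coeff P (?u i) n \<otimes> b i) = s \<otimes> coeff P ?g n"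
    proof (cases "m dvd n")
      case True
      then have "(\<Oplus>i\<in>{..<k}. coeff P (?u i) n \<otimes> b i) = (\<Oplus>i\<in>{..<k}. coeff P (u i) (n div m) \<otimes> b i)"
        using m u b by (intro R.finsum_cong') auto
      then show ?thesis using True m g sg by simp
    next
      case False
      then have "(\<Oplus>i\<in>{..<k}. coeff P (?u i) n \<otimes> b i) = \<zero>"
        using m u b by (intro R.add.finprod_one_eqI) auto
      then show ?thesis using False m g s by simp
    qed
    then show "coeff P (comb k b ?u) n = coeff P (monom P s 0 \<otimes>\<^bsub>P\<^esub> ?g) n"
      using b s by (simp add: coeff_comb monom_mult_is_smult del: coeff_mult coeff_stretch)
  qed (use b in auto)
  \<comment> \<open>Here the summand \<open>?N2\<close> enters, through the coefficients of
    \<open>F f(t^m) g(t^m)\<close>; the reduction by the old rows stays in the new ideal by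
    \<open>relH\<close>.\<close>
  have relz: "H \<otimes>\<^bsub>P\<^esub> comb k b z \<in> poly_ideal N'"
  proof -
    have "F \<otimes>\<^bsub>P\<^esub> stretch m (f \<otimes>\<^bsub>P\<^esub> g) \<in> poly_ideal ?N2"
      using F C cf m f g
      by (intro poly_ideal_mult stretch_mem_poly_ideal mem_poly_ideal_content) (auto intro!: mem_poly_ideal_content)
    then have "F \<otimes>\<^bsub>P\<^esub> (?f \<otimes>\<^bsub>P\<^esub> ?g) \<in> poly_ideal N'" using sub m f g by (auto simp: stretch_mult)
    then have "(D \<otimes>\<^bsub>P\<^esub> monom P s 0) \<otimes>\<^bsub>P\<^esub> (F \<otimes>\<^bsub>P\<^esub> (?f \<otimes>\<^bsub>P\<^esub> ?g)) \<in> poly_ideal N'"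
      by (rule K.I_l_closed) (use D in auto)
    moreover have "(D \<otimes>\<^bsub>P\<^esub> monom P s 0) \<otimes>\<^bsub>P\<^esub> (F \<otimes>\<^bsub>P\<^esub> (?f \<otimes>\<^bsub>P\<^esub> ?g))
        = H \<otimes>\<^bsub>P\<^esub> (D \<otimes>\<^bsub>P\<^esub> comb k b ?u)"
      unfolding comb_u H_def using D F by (simp add: P.m_ac)
    ultimately have 1: "H \<otimes>\<^bsub>P\<^esub> (D \<otimes>\<^bsub>P\<^esub> comb k b ?u) \<in> poly_ideal N'" by simp
    have "(\<Oplus>\<^bsub>P\<^esub>j\<in>{..<l}. H \<otimes>\<^bsub>P\<^esub> (?u j \<otimes>\<^bsub>P\<^esub> comb k b (W j))) \<in> poly_ideal N'"
    proof (intro P.ideal_finsum_closed K.is_ideal)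
      fix j assume "j \<in> {..<l}"
      then have "?u j \<otimes>\<^bsub>P\<^esub> (H \<otimes>\<^bsub>P\<^esub> comb k b (W j)) \<in> poly_ideal N'"
        using relH by (simp add: K.I_l_closed)
      then show "H \<otimes>\<^bsub>P\<^esub> (?u j \<otimes>\<^bsub>P\<^esub> comb k b (W j)) \<in> poly_ideal N'"
        using b W by (simp add: P.m_lcomm)
    qed auto
    moreover have "(\<Oplus>\<^bsub>P\<^esub>j\<in>{..<l}. H \<otimes>\<^bsub>P\<^esub> (?u j \<otimes>\<^bsub>P\<^esub> comb k b (W j))) = H \<otimes>\<^bsub>P\<^esub> comb k b y"
      unfolding y_def using b W by (subst comb_finsum) (auto simp: P.finsum_rdistr)
    ultimately have 2: "H \<otimes>\<^bsub>P\<^esub> comb k b y \<in> poly_ideal N'" by simp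
    have "comb k b z = D \<otimes>\<^bsub>P\<^esub> comb k b ?u \<oplus>\<^bsub>P\<^esub> (\<ominus>\<^bsub>P\<^esub> \<one>\<^bsub>P\<^esub>) \<otimes>\<^bsub>P\<^esub> comb k b y"
      unfolding z_def using b D y by (simp add: comb_add comb_scale)
    then have "H \<otimes>\<^bsub>P\<^esub> comb k b z
        = H \<otimes>\<^bsub>P\<^esub> (D \<otimes>\<^bsub>P\<^esub> comb k b ?u) \<oplus>\<^bsub>P\<^esub> (\<ominus>\<^bsub>P\<^esub> \<one>\<^bsub>P\<^esub>) \<otimes>\<^bsub>P\<^esub> (H \<otimes>\<^bsub>P\<^esub> comb k b y)"
      using b D y by (simp add: P.r_distr P.m_lcomm)
    then show ?thesis using 1 2 by (simp add: K.I_l_closed)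
  qed

  have z_small: "z i = \<zero>\<^bsub>P\<^esub>" if "i < l" for i
  proof -
    have "y i = (\<Oplus>\<^bsub>P\<^esub>j\<in>{..<l}. if i = j then ?u j \<otimes>\<^bsub>P\<^esub> D else \<zero>\<^bsub>P\<^esub>)"
      unfolding y_def using diag D that by (intro P.finsum_cong') auto
    also have "\<dots> = ?u i \<otimes>\<^bsub>P\<^esub> D" using that D by (intro P.finsum_singleton) auto
    finally have "y i = D \<otimes>\<^bsub>P\<^esub> ?u i" using D by (simp add: P.m_comm)
    then show ?thesis unfolding z_def using D by (simp add: P.l_minus P.r_neg)
  qed
  have z_pivot: "z l \<notin> poly_ideal M"
  proof
    assume zM: "z l \<in> poly_ideal M"
    obtain r where r: "coeff P D r \<notin> M" using D unfolding poly_ideal_def by blast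
    have rm: "r < m"
    proof (rule ccontr)
      assume "\<not> r < m"
      then have "coeff P D r = \<zero>" using m D by (intro deg_aboveD) auto
      then show False using r M.zero_closed by simp
    qed
    \<comment> \<open>Exponent \<open>r\<close> in the old variable and \<open>e l\<close> in the
      new one. For \<open>j < l\<close> the coefficient of \<open>u j\<close> at \<open>e l\<close>
      is 0, so \<open>y l\<close> contributes nothing, while \<open>D\<close> and \<open>u l\<close>
      contribute a coefficient of \<open>D\<close> outside \<open>M\<close> times
      \<open>s\<close>.\<close>
    let ?n = "m * e l + r"
    have "coeff P (y l) ?n = (\<Oplus>j\<in>{..<l}. coeff P (?u j \<otimes>\<^bsub>P\<^esub> W j l) ?n)"
      unfolding y_def using W by (intro coeff_finsum) auto
    also have "\<dots> = \<zero>"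
    proof (rule R.add.finprod_one_eqI)
      fix j assume "j \<in> {..<l}"
      then have "coeff P (W j l \<otimes>\<^bsub>P\<^esub> ?u j) ?n = coeff P (W j l) r \<otimes> coeff P (u j) (e l)"
        using W u mW rm by (intro coeff_mult_stretch) auto
      also have "\<dots> = \<zero>" using e[of l j] \<open>j \<in> {..<l}\<close> lk W by simp
      finally show "coeff P (?u j \<otimes>\<^bsub>P\<^esub> W j l) ?n = \<zero>"
        using W by (simp add: P.m_comm del: coeff_mult)
    qed
    finally have yn: "coeff P (y l) ?n = \<zero>" .
    have "coeff P (D \<otimes>\<^bsub>P\<^esub> ?u l) ?n = coeff P D r \<otimes> coeff P (u l) (e l)"
      using D u m rm by (intro coeff_mult_stretch) auto
    then have "coeff P (z l) ?n = coeff P D r \<otimes> s"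
      unfolding z_def using D y yn e[of l l] lk s by (simp add: P.l_minus del: coeff_mult)
    then have "coeff P D r \<otimes> s \<in> M" using zM by (metis (mono_tags, lifting) mem_Collect_eq poly_ideal_def)
    then show False using M.I_prime[of "coeff P D r" s] r s D by auto
  qed

  \<comment> \<open>The new pivot clears column \<open>l\<close> in the old rows. As
    \<open>z\<close> vanishes in the first \<open>l\<close> columns, the old diagonal is only scaled
    by \<open>z l\<close>; the new row is scaled by \<open>D\<close> to match.\<close>
  define D' where "D' = D \<otimes>\<^bsub>P\<^esub> z l"
  define W' where "W' = (\<lambda>j i. if j < l
    then z l \<otimes>\<^bsub>P\<^esub> W j i \<oplus>\<^bsub>P\<^esub> (\<ominus>\<^bsub>P\<^esub> W j l) \<otimes>\<^bsub>P\<^esub> z i else D \<otimes>\<^bsub>P\<^esub> z i)"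
  have "content R H = C \<cdot>\<^bsub>R\<^esub> content R f"
  proof
    show "content R H \<subseteq> C \<cdot>\<^bsub>R\<^esub> content R f"
      unfolding H_def using F C cf m f
      by (intro content_subset poly_ideal_mult stretch_mem_poly_ideal R.ideal_prod_is_ideal)
        (auto intro!: mem_poly_ideal_content)
    \<comment> \<open>Each product with \<open>r < m\<close> is a single coefficient of
      \<open>H\<close>; beyond the degree of \<open>F\<close> the product is 0.\<close>
    have "coeff P F r \<otimes> coeff P f q \<in> content R H" for r q
    proof (cases "r < m")
      case True
      then have "coeff P H (m * q + r) = coeff P F r \<otimes> coeff P f q"
        unfolding H_def using F m f by (intro coeff_mult_stretch) auto
      then show ?thesis using coeff_mem_content[OF H] by metis
    next
      case False
      then have "coeff P F r = \<zero>" using m F by (intro deg_aboveD) auto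
      then show ?thesis using f content_ideal[OF H]
        by (simp add: additive_subgroup.zero_closed ideal.axioms(1))
    qed
    then show "C \<cdot>\<^bsub>R\<^esub> content R f \<subseteq> content R H"
      unfolding F(2)[symmetric] unfolding content_def[of R F] content_def[of R f] P_def[symmetric]
      using F f by (intro R.ideal_prod_Idl_subset content_ideal[OF H]) auto
  qed
  moreover have "D' \<in> carrier P" "D' \<notin> poly_ideal M"
    unfolding D'_def using D z z_pivot poly_ideal_prime_mult[OF M] by auto
  moreover have "W' j i \<in> carrier P" for j i
    unfolding W'_def using W z D by auto
  moreover have "W' j i = (if i = j then D' else \<zero>\<^bsub>P\<^esub>)" if "j < Suc l" "i < Suc l" for j i
  proof (cases "j < l")
    case True
    show ?thesis
    proof (cases "i < l")
      case i: True
      then show ?thesis unfolding W'_def D'_def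
        using True diag[OF True i] z_small[OF i] z[of l] W[of j l] D by (auto simp: P.m_comm)
    next
      case False
      then have "i = l" using that by simp
      then show ?thesis unfolding W'_def using True W[of j l] z[of l]
        by (simp add: P.l_minus P.m_comm[of "W j l"] P.r_neg)
    qed
  next
    case False
    then have "j = l" "i < l \<or> i = l" using that by auto
    then show ?thesis unfolding W'_def D'_def using z_small[of i] D by auto
  qed
  moreover have "H \<otimes>\<^bsub>P\<^esub> comb k b (W' j) \<in> poly_ideal N'" if "j < Suc l" for j
  proof (cases "j < l")
    case True
    then have "comb k b (W' j) = z l \<otimes>\<^bsub>P\<^esub> comb k b (W j) \<oplus>\<^bsub>P\<^esub> (\<ominus>\<^bsub>P\<^esub> W j l) \<otimes>\<^bsub>P\<^esub> comb k b z"
      unfolding W'_def using b W z by (simp add: comb_add comb_scale)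
    then have "H \<otimes>\<^bsub>P\<^esub> comb k b (W' j)
        = z l \<otimes>\<^bsub>P\<^esub> (H \<otimes>\<^bsub>P\<^esub> comb k b (W j)) \<oplus>\<^bsub>P\<^esub> (\<ominus>\<^bsub>P\<^esub> W j l) \<otimes>\<^bsub>P\<^esub> (H \<otimes>\<^bsub>P\<^esub> comb k b z)"
      using b W z by (simp add: P.r_distr P.m_lcomm)
    then show ?thesis using relH[OF True] relz z W by (simp add: K.I_l_closed)
  next
    case False
    then have "comb k b (W' j) = D \<otimes>\<^bsub>P\<^esub> comb k b z"
      unfolding W'_def using b D z by (simp add: comb_scale)
    then have "H \<otimes>\<^bsub>P\<^esub> comb k b (W' j) = D \<otimes>\<^bsub>P\<^esub> (H \<otimes>\<^bsub>P\<^esub> comb k b z)"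
      using b D z by (simp add: P.m_lcomm)
    then show ?thesis using relz D by (simp add: K.I_l_closed)
  qed
  ultimately show ?thesis unfolding N'_def using H by blast
qed

end

section \<open>The polarized Dedekind--Mertens formula\<close>

context cring
begin

lemma ideals_set_simps [simp]:
  "carrier (ideals_set R) = {I. ideal I R}" "monoid.mult (ideals_set R) = ideal_prod R"
  "ring.add (ideals_set R) = set_add R" "monoid.one (ideals_set R) = carrier R" "ring.zero (ideals_set R) = {\<zero>}"
  by (simp_all add: ideals_set_def)

text \<open>For \<open>i \<le> l\<close> every omitted product contains the factor
  \<open>c (Suc l)\<close>, which distributivity pulls out; only the last summand omits it. The
  result has the form of the ideal in \<open>elimination_step\<close>.\<close>

lemma ideals_omitted_product_sum_Suc:
  fixes a c :: "nat \<Rightarrow> 'a set" and l :: nat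
  assumes "\<And>i. i \<in> {1..Suc l} \<Longrightarrow> ideal (a i) R" "\<And>i. i \<in> {1..Suc l} \<Longrightarrow> ideal (c i) R"
  shows "(\<Oplus>\<^bsub>ideals_set R\<^esub>i\<in>{1..Suc l}. a i \<cdot> (\<Otimes>\<^bsub>ideals_set R\<^esub>j\<in>{1..Suc l} - {i}. c j))
    = (\<Oplus>\<^bsub>ideals_set R\<^esub>i\<in>{1..l}. a i \<cdot> (\<Otimes>\<^bsub>ideals_set R\<^esub>j\<in>{1..l} - {i}. c j)) \<cdot> c (Suc l)
      <+>\<^bsub>R\<^esub> (\<Otimes>\<^bsub>ideals_set R\<^esub>j\<in>{1..l}. c j) \<cdot> a (Suc l)"
proof -
  let ?S = "ideals_set R"
  interpret S: semiring ?S by (rule ideals_set_is_semiring)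
  interpret SM: comm_monoid ?S by (rule ideals_set_is_comm_monoid)
  let ?c = "\<lambda>A. \<Otimes>\<^bsub>?S\<^esub>j\<in>A. c j"
  have c: "ideal (?c A) R" if "A \<subseteq> {1..Suc l}" for A
  proof -
    have "?c A \<in> carrier ?S" using assms(2) that by (intro SM.finprod_closed) auto
    then show ?thesis by simp
  qed
  have ac: "ideal (a i \<cdot> ?c A) R" if "i \<in> {1..Suc l}" "A \<subseteq> {1..Suc l}" for i A
    using assms(1) c that by (simp add: ideal_prod_is_ideal)
  have sub: "{1..l} - A \<subseteq> {1..Suc l}" "{1..Suc l} - A \<subseteq> {1..Suc l}" for A by auto
  note ac' = ac[OF _ sub(1)] ac[OF _ sub(2)]
  have step: "a i \<cdot> ?c ({1..Suc l} - {i}) = a i \<cdot> ?c ({1..l} - {i}) \<cdot> c (Suc l)" if "i \<in> {1..l}" for i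
  proof -
    have "{1..Suc l} - {i} = insert (Suc l) ({1..l} - {i})" using that by auto
    moreover have "?c (insert (Suc l) ({1..l} - {i})) = c (Suc l) \<otimes>\<^bsub>?S\<^esub> ?c ({1..l} - {i})"
      using assms(2) by (intro SM.finprod_insert) auto
    ultimately have eq: "?c ({1..Suc l} - {i}) = c (Suc l) \<cdot> ?c ({1..l} - {i})" by simp
    note ci = c[OF sub(1)]
    note eq
    also have "c (Suc l) \<cdot> ?c ({1..l} - {i}) = ?c ({1..l} - {i}) \<cdot> c (Suc l)"
      using assms(2)[of "Suc l"] ci by (intro ideal_prod_commute) auto
    finally show ?thesis
      using assms ci that by (subst ideal_prod_assoc) auto
  qed
  let ?X = "\<Oplus>\<^bsub>?S\<^esub>i\<in>{1..l}. a i \<cdot> ?c ({1..l} - {i})"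
  have X: "ideal ?X R"
  proof -
    have "?X \<in> carrier ?S" using ac' by (intro S.finsum_closed) auto
    then show ?thesis by simp
  qed
  have "(\<Oplus>\<^bsub>?S\<^esub>i\<in>{1..Suc l}. a i \<cdot> ?c ({1..Suc l} - {i}))
      = (\<Oplus>\<^bsub>?S\<^esub>i\<in>insert (Suc l) {1..l}. a i \<cdot> ?c ({1..Suc l} - {i}))"
    by (simp add: atLeastAtMostSuc_conv)
  also have "\<dots> = a (Suc l) \<cdot> ?c ({1..Suc l} - {Suc l})
      \<oplus>\<^bsub>?S\<^esub> (\<Oplus>\<^bsub>?S\<^esub>i\<in>{1..l}. a i \<cdot> ?c ({1..Suc l} - {i}))"
    using ac' by (intro S.finsum_insert) auto
  also have "{1..Suc l} - {Suc l} = {1..l}" by auto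
  also have "(\<Oplus>\<^bsub>?S\<^esub>i\<in>{1..l}. a i \<cdot> ?c ({1..Suc l} - {i}))
      = (\<Oplus>\<^bsub>?S\<^esub>i\<in>{1..l}. a i \<cdot> ?c ({1..l} - {i}) \<otimes>\<^bsub>?S\<^esub> c (Suc l))"
  proof (rule S.finsum_cong'[OF refl])
    show "(\<lambda>i. a i \<cdot> ?c ({1..l} - {i}) \<otimes>\<^bsub>?S\<^esub> c (Suc l)) \<in> {1..l} \<rightarrow> carrier ?S"
      using ac' assms(2) by (auto simp: ideal_prod_is_ideal)
  qed (simp only: step ideals_set_simps)
  also have "\<dots> = ?X \<otimes>\<^bsub>?S\<^esub> c (Suc l)"
    using ac' assms(2) by (intro S.finsum_ldistr[symmetric]) auto
  also have "a (Suc l) \<cdot> ?c {1..l} = ?c {1..l} \<cdot> a (Suc l)"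
    using assms c by (intro ideal_prod_commute) auto
  finally show ?thesis
    using X assms c[of "{1..l}"]
    by (simp add: set_add_comm ideal.Icarr subsetI ideal_prod_is_ideal ideal_prod_in_carrier)
qed

end

section \<open>Choice of pivots, and both sides of the formula by recursion\<close>

context UP_cring
begin

text \<open>At a pivot exponent \<open>e i\<close> the coefficient of \<open>s g\<close> is
  \<open>s\<close> times \<open>b i\<close>, so the representation there can be prescribed as a unit
  row times \<open>s\<close>. At the other exponents any representation will do.\<close>

lemma pivot_coefficients:
  assumes M: "primeideal M R" and g: "g \<in> carrier P"
    and B: "finite B" "B \<subseteq> content R g" "card B \<le> k" "content R g \<subseteq> saturation R M (Idl B)"
  obtains b s u e where "\<And>j. b j \<in> carrier R" "s \<in> carrier R - M" "\<And>j. u j \<in> carrier P"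
    "\<And>n. s \<otimes> coeff P g n = (\<Oplus>j\<in>{..<k}. coeff P (u j) n \<otimes> b j)"
    "\<And>i j. i < k \<Longrightarrow> j < k \<Longrightarrow> coeff P (u j) (e i) = (if i = j then s else \<zero>)"
proof -
  interpret M: primeideal M R by fact
  let ?G = "range (coeff P g)"
  have G: "?G \<subseteq> carrier R" using g by auto
  have cg: "content R g = Idl ?G" by (simp add: content_def P_def)
  obtain N where N: "\<And>n. N \<le> n \<Longrightarrow> coeff P g n = \<zero>" using coeff_eventually_zero[OF g] by blast
  have "?G \<subseteq> insert \<zero> (coeff P g ` {..<N})"
    using N by (auto simp: image_iff) (metis lessThan_iff not_le)
  then have finG: "finite ?G" by (rule finite_subset) simp
  have BR: "B \<subseteq> carrier R" using B(2) ideal.Icarr[OF content_ideal[OF g]] by blast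
  obtain E where E: "finite E" "E \<subseteq> ?G" "card E \<le> card B" "?G \<subseteq> saturation R M (Idl E)"
  proof (rule M.generators_among[OF B(1) BR G])
    show "B \<subseteq> saturation R M (Idl ?G)"
      using B(2) M.subset_saturation[of "content R g"] ideal.Icarr[OF content_ideal[OF g]]
      unfolding cg by blast
    show "?G \<subseteq> saturation R M (Idl B)"
      using B(4) R.genideal_self[OF G] unfolding cg by blast
  qed
  \<comment> \<open>One exponent for each chosen coefficient, as a value may occur in
    \<open>g\<close> several times.\<close>
  obtain I0 where I0: "inj_on (coeff P g) I0" "E = coeff P g ` I0"
    using E(2) by (auto simp: subset_image_inj)
  have fin0: "finite I0" "card I0 \<le> k"
    using E B(3) I0 by (auto simp: card_image dest: finite_imageD)
  obtain J where J: "J \<subseteq> UNIV - I0" "finite J" "card J = k - card I0"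
    using infinite_arbitrarily_large[of "UNIV - I0" "k - card I0"] fin0(1) by auto
  define I1 where "I1 = I0 \<union> J"
  have "card I1 = k" unfolding I1_def using fin0 J by (subst card_Un_disjoint) auto
  moreover have fin1: "finite I1" using fin0 J by (simp add: I1_def)
  ultimately obtain e where "bij_betw e {0..<k} I1" using ex_bij_betw_nat_finite by blast
  then have e: "inj_on e {..<k}" "e ` {..<k} = I1"
    by (auto simp: bij_betw_def lessThan_atLeast0)
  define b where "b = (\<lambda>j. coeff P g (e j))"
  have b: "b j \<in> carrier R" for j using g by (simp add: b_def)
  have "b ` {..<k} = coeff P g ` I1" using e(2) by (auto simp: b_def)
  then have bE: "b ` {..<k} \<subseteq> carrier R" "E \<subseteq> b ` {..<k}"
    using g I0(2) by (auto simp: I1_def)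
  have idE: "ideal (Idl (b ` {..<k})) R" using bE by (intro R.genideal_ideal)
  have "E \<subseteq> saturation R M (Idl (b ` {..<k}))"
    using bE(2) R.genideal_self[OF bE(1)] M.subset_saturation[of "Idl (b ` {..<k})"]
      ideal.Icarr[OF idE] by (meson order_trans subsetI)
  then have "?G \<subseteq> saturation R M (Idl (b ` {..<k}))"
    using E(4) M.Idl_subset_saturation[OF _ idE] by blast
  then obtain s where s: "s \<in> carrier R - M" "\<And>x. x \<in> ?G \<Longrightarrow> s \<otimes> x \<in> Idl (b ` {..<k})"
    using M.saturation_common_multiplier[OF finG idE] by blast
  have "\<exists>v. (\<forall>j. v j \<in> carrier R) \<and> s \<otimes> coeff P g n = (\<Oplus>j\<in>{..<k}. v j \<otimes> b j)" for n
  proof -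
    have "s \<otimes> coeff P g n \<in> Idl (b ` {..<k})" using s(2) by simp
    from R.Idl_image_lessThanE[OF b this] show ?thesis by metis
  qed
  then obtain v where v: "\<And>n j. v n j \<in> carrier R"
    "\<And>n. s \<otimes> coeff P g n = (\<Oplus>j\<in>{..<k}. v n j \<otimes> b j)" by metis
  \<comment> \<open>Cutting off at \<open>N\<close>, where \<open>g\<close> has ended, makes
    \<open>u j\<close> a polynomial; only the finitely many pivots can lie beyond.\<close>
  define u where "u = (\<lambda>j n. if n \<in> I1 then if n = e j then s else \<zero> else if n < N then v n j else \<zero>)"
  obtain N1 where N1: "\<And>i. i \<in> I1 \<Longrightarrow> i < N1" using fin1 finite_nat_set_iff_bounded by auto
  have u_up: "u j \<in> up R" for j
  proof (rule mem_upI)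
    show "u j n \<in> carrier R" for n using s(1) v by (simp add: u_def)
    have "u j n = \<zero>" if "N + N1 < n" for n
      using that N1[of n] by (auto simp: u_def)
    then show "\<exists>n. bound \<zero> n (u j)" by (auto intro: bound.intro)
  qed
  then have u: "u j \<in> carrier P" "coeff P (u j) n = u j n" for j n
    by (auto simp: P_def UP_def)
  have ue: "u j (e i) = (if i = j then s else \<zero>)" if "i < k" "j < k" for i j
  proof -
    have "e i \<in> I1" using e that by auto
    moreover have "e i = e j \<longleftrightarrow> i = j" using e that by (auto simp: inj_on_def)
    ultimately show ?thesis by (auto simp: u_def)
  qed
  have sg: "s \<otimes> coeff P g n = (\<Oplus>j\<in>{..<k}. u j n \<otimes> b j)" for n
  proof (cases "n \<in> I1")
    case True
    then obtain i where i: "i < k" "n = e i" using e by auto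
    have "(\<Oplus>j\<in>{..<k}. u j n \<otimes> b j) = (\<Oplus>j\<in>{..<k}. if i = j then s \<otimes> b j else \<zero>)"
      using i ue b s(1) by (intro R.finsum_cong') auto
    also have "\<dots> = s \<otimes> b i" using i b s(1) by (intro R.finsum_singleton) auto
    finally show ?thesis using i by (simp add: b_def)
  next
    case n: False
    show ?thesis
    proof (cases "n < N")
      case True
      then show ?thesis using n v by (simp add: u_def)
    next
      case False
      then have "(\<Oplus>j\<in>{..<k}. u j n \<otimes> b j) = \<zero>"
        using n b by (intro R.add.finprod_one_eqI) (simp add: u_def)
      then show ?thesis using False N s(1) by simp
    qed
  qed
  show ?thesis by (rule that[of b s u e]) (use b s(1) u ue sg in auto)
qed

text \<open>This and \<open>polarized_sum\<close> truncate the formula to the first \<open>l\<close>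
  polynomials, for an induction that adds one variable at a time.\<close>

definition content_prod :: "(nat \<Rightarrow> nat \<Rightarrow> 'a) \<Rightarrow> nat \<Rightarrow> 'a set" where
  "content_prod f l = (\<Otimes>\<^bsub>ideals_set R\<^esub>j\<in>{1..l}. content R (f j))"

definition polarized_sum :: "(nat \<Rightarrow> 'a) \<Rightarrow> (nat \<Rightarrow> nat \<Rightarrow> 'a) \<Rightarrow> nat \<Rightarrow> 'a set" where
  "polarized_sum g f l = (\<Oplus>\<^bsub>ideals_set R\<^esub>i\<in>{1..l}. content R (f i \<otimes>\<^bsub>P\<^esub> g) \<cdot>\<^bsub>R\<^esub>
     (\<Otimes>\<^bsub>ideals_set R\<^esub>j\<in>{1..l} - {i}. content R (f j)))"

lemma content_prod_0: "content_prod f 0 = carrier R"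
proof -
  interpret SM: comm_monoid "ideals_set R" by (rule R.ideals_set_is_comm_monoid)
  show ?thesis by (simp add: content_prod_def)
qed

lemma polarized_sum_0: "polarized_sum g f 0 = {\<zero>}"
proof -
  interpret S: semiring "ideals_set R" by (rule R.ideals_set_is_semiring)
  show ?thesis by (simp add: polarized_sum_def)
qed

lemma content_prod_ideal:
  assumes "f \<in> {1..l} \<rightarrow> carrier P"
  shows "ideal (content_prod f l) R"
proof -
  interpret SM: comm_monoid "ideals_set R" by (rule R.ideals_set_is_comm_monoid)
  have "content_prod f l \<in> carrier (ideals_set R)"
    unfolding content_prod_def
    using assms by (intro SM.finprod_closed) (auto intro!: content_ideal simp: Pi_def)
  then show ?thesis by simp
qed

lemma content_prod_Suc:
  assumes "f \<in> {1..Suc l} \<rightarrow> carrier P"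
  shows "content_prod f (Suc l) = content_prod f l \<cdot>\<^bsub>R\<^esub> content R (f (Suc l))"
proof -
  interpret SM: comm_monoid "ideals_set R" by (rule R.ideals_set_is_comm_monoid)
  have f: "f (Suc l) \<in> carrier P" "f \<in> {1..l} \<rightarrow> carrier P" using assms by (auto simp: Pi_def)
  have "content_prod f (Suc l) = (\<Otimes>\<^bsub>ideals_set R\<^esub>j\<in>insert (Suc l) {1..l}. content R (f j))"
    by (simp add: content_prod_def atLeastAtMostSuc_conv)
  also have "\<dots> = content R (f (Suc l)) \<otimes>\<^bsub>ideals_set R\<^esub> content_prod f l"
    unfolding content_prod_def
    using f by (intro SM.finprod_insert) (auto intro!: content_ideal simp: Pi_def)
  also have "\<dots> = content_prod f l \<cdot>\<^bsub>R\<^esub> content R (f (Suc l))"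
    using f by (simp add: R.ideal_prod_commute content_ideal content_prod_ideal)
  finally show ?thesis .
qed

lemma polarized_sum_Suc:
  assumes "f \<in> {1..Suc l} \<rightarrow> carrier P" "g \<in> carrier P"
  shows "polarized_sum g f (Suc l) = polarized_sum g f l \<cdot>\<^bsub>R\<^esub> content R (f (Suc l))
    <+>\<^bsub>R\<^esub> content_prod f l \<cdot>\<^bsub>R\<^esub> content R (f (Suc l) \<otimes>\<^bsub>P\<^esub> g)"
  unfolding polarized_sum_def content_prod_def using assms
  by (intro R.ideals_omitted_product_sum_Suc[where a = "\<lambda>i. content R (f i \<otimes>\<^bsub>P\<^esub> g)"
        and c = "\<lambda>i. content R (f i)"]) (auto intro!: content_ideal simp: Pi_def)

lemma polarized_sum_ideal:
  assumes "f \<in> {1..l} \<rightarrow> carrier P" "g \<in> carrier P"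
  shows "ideal (polarized_sum g f l) R"
  using assms(1)
proof (induct l)
  case 0
  show ?case unfolding polarized_sum_0 by (rule R.zeroideal)
next
  case (Suc l)
  have "ideal (polarized_sum g f l) R" using Suc by (auto simp: Pi_def)
  then show ?case unfolding polarized_sum_Suc[OF Suc.prems assms(2)]
    using Suc.prems assms(2) content_prod_ideal[of f l]
    by (intro R.add_ideals R.ideal_prod_is_ideal content_ideal) (auto simp: Pi_def)
qed

text \<open>The easy inclusion, from \<open>c(f g) \<subseteq> c(f) c(g)\<close> applied in each
  summand; it holds for every number of polynomials.\<close>

lemma polarized_sum_subset:
  assumes "f \<in> {1..l} \<rightarrow> carrier P" "g \<in> carrier P"
  shows "polarized_sum g f l \<subseteq> content_prod f l \<cdot>\<^bsub>R\<^esub> content R g"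
  using assms(1)
proof (induct l)
  case 0
  have "ideal (carrier R \<cdot>\<^bsub>R\<^esub> content R g) R"
    using assms(2) by (intro R.ideal_prod_is_ideal R.oneideal content_ideal)
  then show ?case unfolding polarized_sum_0 content_prod_0
    by (simp add: additive_subgroup.zero_closed ideal.axioms(1))
next
  case (Suc l)
  let ?f = "f (Suc l)"
  have f: "?f \<in> carrier P" using Suc.prems by (auto simp: Pi_def)
  note C = content_prod_Suc[OF Suc.prems]
  have "ideal (content_prod f l) R" using Suc.prems by (intro content_prod_ideal) (auto simp: Pi_def)
  note id = this content_ideal[OF f] content_ideal[OF assms(2)]
  have IH: "polarized_sum g f l \<subseteq> content_prod f l \<cdot>\<^bsub>R\<^esub> content R g" using Suc by (auto simp: Pi_def)
  have "polarized_sum g f l \<cdot>\<^bsub>R\<^esub> content R ?f \<subseteq> content_prod f l \<cdot>\<^bsub>R\<^esub> content R g \<cdot>\<^bsub>R\<^esub> content R ?f"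
    using IH by (intro R.ideal_prod_mono) auto
  also have "\<dots> = content_prod f (Suc l) \<cdot>\<^bsub>R\<^esub> content R g"
    unfolding C using id by (metis R.ideal_prod_assoc R.ideal_prod_commute)
  finally have 1: "polarized_sum g f l \<cdot>\<^bsub>R\<^esub> content R ?f \<subseteq> content_prod f (Suc l) \<cdot>\<^bsub>R\<^esub> content R g" .
  have "content_prod f l \<cdot>\<^bsub>R\<^esub> content R (?f \<otimes>\<^bsub>P\<^esub> g)
      \<subseteq> content_prod f l \<cdot>\<^bsub>R\<^esub> (content R ?f \<cdot>\<^bsub>R\<^esub> content R g)"
    using content_mult_subset[OF f assms(2)] by (intro R.ideal_prod_mono) auto
  also have "\<dots> = content_prod f (Suc l) \<cdot>\<^bsub>R\<^esub> content R g"
    unfolding C using id by (simp add: R.ideal_prod_assoc)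
  finally have 2: "content_prod f l \<cdot>\<^bsub>R\<^esub> content R (?f \<otimes>\<^bsub>P\<^esub> g) \<subseteq> content_prod f (Suc l) \<cdot>\<^bsub>R\<^esub> content R g" .
  have "ideal (content_prod f (Suc l) \<cdot>\<^bsub>R\<^esub> content R g) R"
    unfolding C using id by (intro R.ideal_prod_is_ideal)
  then show ?case unfolding polarized_sum_Suc[OF Suc.prems assms(2)]
    using 1 2 by (intro R.set_add_least)
qed

text \<open>The hard inclusion, local at \<open>M\<close>: after \<open>k\<close> elimination steps
  the system is \<open>D\<close> times the identity, and \<open>D\<close> and \<open>s\<close> can
  be cancelled modulo a saturated ideal.\<close>

lemma content_prod_subset_saturation:
  assumes M: "primeideal M R" and g: "g \<in> carrier P"
    and f: "f \<in> {1..k} \<rightarrow> carrier P"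
    and B: "finite B" "B \<subseteq> content R g" "card B \<le> k" "content R g \<subseteq> saturation R M (Idl B)"
  shows "content_prod f k \<cdot>\<^bsub>R\<^esub> content R g \<subseteq> saturation R M (polarized_sum g f k)"
proof -
  interpret M: primeideal M R by fact
  obtain b s u e where b: "\<And>j. b j \<in> carrier R" and s: "s \<in> carrier R - M"
    and u: "\<And>j. u j \<in> carrier P"
    and sg: "\<And>n. s \<otimes> coeff P g n = (\<Oplus>j\<in>{..<k}. coeff P (u j) n \<otimes> b j)"
    and e: "\<And>i j. i < k \<Longrightarrow> j < k \<Longrightarrow> coeff P (u j) (e i) = (if i = j then s else \<zero>)"
    by (rule pivot_coefficients[OF M g B]) (rule that)
  have "\<exists>F D W. F \<in> carrier P \<and> content R F = content_prod f l
    \<and> D \<in> carrier P \<and> D \<notin> poly_ideal M \<and> (\<forall>j i. W j i \<in> carrier P)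
    \<and> (\<forall>j<l. \<forall>i<l. W j i = (if i = j then D else \<zero>\<^bsub>P\<^esub>))
    \<and> (\<forall>j<l. F \<otimes>\<^bsub>P\<^esub> comb k b (W j) \<in> poly_ideal (polarized_sum g f l))" if "l \<le> k" for l
    using that
  proof (induct l)
    case 0
    \<comment> \<open>The elimination starts with \<open>F = D = 1\<close>; the conditions on rows
      are vacuous.\<close>
    have "content R \<one>\<^bsub>P\<^esub> = carrier R"
      using coeff_mem_content[of "\<one>\<^bsub>P\<^esub>" 0] content_ideal[of "\<one>\<^bsub>P\<^esub>"]
      by (simp add: ideal.one_imp_carrier)
    moreover have "\<one>\<^bsub>P\<^esub> \<notin> poly_ideal M"
      using M.one_compl by (auto simp: poly_ideal_def dest: spec[of _ 0])
    ultimately show ?case unfolding content_prod_0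
      by (intro exI[of _ "\<one>\<^bsub>P\<^esub>"] exI[of _ "\<lambda>_ _. \<zero>\<^bsub>P\<^esub>"]) auto
  next
    case (Suc l)
    then obtain F D W where F: "F \<in> carrier P" "content R F = content_prod f l"
      and D: "D \<in> carrier P" "D \<notin> poly_ideal M" and W: "\<And>j i. W j i \<in> carrier P"
      and diag: "\<And>j i. j < l \<Longrightarrow> i < l \<Longrightarrow> W j i = (if i = j then D else \<zero>\<^bsub>P\<^esub>)"
      and rel: "\<And>j. j < l \<Longrightarrow> F \<otimes>\<^bsub>P\<^esub> comb k b (W j) \<in> poly_ideal (polarized_sum g f l)"
      by (metis Suc_leD)
    have fl: "f \<in> {1..Suc l} \<rightarrow> carrier P" using f Suc.prems by (auto simp: Pi_def)
    have C: "ideal (content_prod f l) R" using fl by (intro content_prod_ideal) (auto simp: Pi_def)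
    have N: "ideal (polarized_sum g f l) R" using fl g by (intro polarized_sum_ideal) (auto simp: Pi_def)
    show ?case
      unfolding content_prod_Suc[OF fl] polarized_sum_Suc[OF fl g]
      by (rule elimination_step[OF M C N _ g _ b s u sg e F D W diag rel])
        (use fl Suc.prems in \<open>auto simp: Pi_def\<close>)
  qed
  from this[of k] obtain F D W where F: "F \<in> carrier P" "content R F = content_prod f k"
    and D: "D \<in> carrier P" "D \<notin> poly_ideal M" and W: "\<And>j i. W j i \<in> carrier P"
    and diag: "\<And>j i. j < k \<Longrightarrow> i < k \<Longrightarrow> W j i = (if i = j then D else \<zero>\<^bsub>P\<^esub>)"
    and rel: "\<And>j. j < k \<Longrightarrow> F \<otimes>\<^bsub>P\<^esub> comb k b (W j) \<in> poly_ideal (polarized_sum g f k)"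
    by blast
  define N where "N = polarized_sum g f k"
  have N: "ideal N R" unfolding N_def using f g by (intro polarized_sum_ideal)
  let ?S = "saturation R M N"
  interpret S: ideal ?S R by (rule M.saturation_ideal[OF N])
  have NS: "N \<subseteq> ?S" using ideal.Icarr[OF N] by (intro M.subset_saturation subsetI)
  \<comment> \<open>With all \<open>k\<close> columns diagonal, row \<open>j\<close> evaluates to
    \<open>D\<close> times \<open>b j\<close>, and Gauss' lemma removes \<open>D\<close>.\<close>
  have Fb: "coeff P F n \<otimes> b j \<in> ?S" if "j < k" for n j
  proof -
    have "comb k b (W j) = comb k b (\<lambda>i. if i = j then D else \<zero>\<^bsub>P\<^esub>)"
      unfolding comb_def using diag[OF that] D b by (intro P.finsum_cong') auto
    also have "\<dots> = D \<otimes>\<^bsub>P\<^esub> monom P (b j) 0" using b D that by (intro comb_diagonal)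
    finally have "F \<otimes>\<^bsub>P\<^esub> (D \<otimes>\<^bsub>P\<^esub> monom P (b j) 0) \<in> poly_ideal ?S"
      using rel[OF that] poly_ideal_mono[OF NS] by (auto simp: N_def)
    then have "(monom P (b j) 0 \<otimes>\<^bsub>P\<^esub> F) \<otimes>\<^bsub>P\<^esub> D \<in> poly_ideal ?S"
      using F D b by (simp add: P.m_ac)
    then have "monom P (b j) 0 \<otimes>\<^bsub>P\<^esub> F \<in> poly_ideal ?S"
      by (rule poly_ideal_cancel[OF M S.is_ideal M.saturation_cancel, rotated -1]) (use F D b in auto)
    then have "coeff P (monom P (b j) 0 \<otimes>\<^bsub>P\<^esub> F) n \<in> ?S" by (simp add: poly_ideal_def)
    then show ?thesis using b F
      by (simp add: monom_mult_is_smult R.m_comm del: coeff_mult)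
  qed
  \<comment> \<open>By \<open>sg\<close>, \<open>s\<close> times a coefficient of \<open>g\<close>
    is a combination of the \<open>b j\<close>, each of which \<open>Fb\<close> handles.\<close>
  have "coeff P F n \<otimes> coeff P g i \<in> ?S" for n i
  proof (rule M.saturation_cancel[OF s])
    have "s \<otimes> (coeff P F n \<otimes> coeff P g i) = coeff P F n \<otimes> (\<Oplus>j\<in>{..<k}. coeff P (u j) i \<otimes> b j)"
      unfolding sg[symmetric] using s F g by (simp add: R.m_lcomm)
    also have "\<dots> = (\<Oplus>j\<in>{..<k}. coeff P F n \<otimes> (coeff P (u j) i \<otimes> b j))"
      using F u b by (intro R.finsum_rdistr) auto
    also have "\<dots> \<in> ?S"
    proof (intro R.ideal_finsum_closed S.is_ideal)
      fix j assume "j \<in> {..<k}"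
      then have "coeff P (u j) i \<otimes> (coeff P F n \<otimes> b j) \<in> ?S" using Fb u by (simp add: S.I_l_closed)
      then show "coeff P F n \<otimes> (coeff P (u j) i \<otimes> b j) \<in> ?S" using F u b by (simp add: R.m_lcomm)
    qed auto
    finally show "s \<otimes> (coeff P F n \<otimes> coeff P g i) \<in> ?S" .
  qed (use F g in auto)
  then show ?thesis
    unfolding F(2)[symmetric] N_def[symmetric]
    unfolding content_def[of R F] content_def[of R g] P_def[symmetric]
    using F g by (intro R.ideal_prod_Idl_subset S.is_ideal) auto
qed

end

section \<open>Passage from local to global\<close>

theorem theorem2p5:
  fixes R (structure)
  assumes "cring R"
    and "g \<in> carrier (UP R)"
    and "g \<noteq> \<zero>\<^bsub>UP R\<^esub>"
  shows "polarized_DM_number R g \<le> local_num_gens R (content R g)"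
proof (cases "local_num_gens R (content R g)")
  case infinity
  then show ?thesis by simp
next
  case (enat k)
  interpret UP_cring R "UP R" by (rule UP_cring.intro[OF assms(1)])
  note g = assms(2)
  have local_gens: "\<exists>B. finite B \<and> B \<subseteq> content R g \<and> card B \<le> k
      \<and> content R g \<subseteq> saturation R M (Idl B)" if M: "maximalideal M R" for M
  proof -
    interpret M: primeideal M R using R.maximalideal_prime[OF M] .
    have "min_num_gens (local_ring_at R M) (extend_at R M (content R g)) \<le> enat k"
      unfolding enat[symmetric] local_num_gens_def using M by (intro SUP_upper) simp
    then show ?thesis using M.local_generators[OF content_ideal[OF g]] by metis
  qed
  \<comment> \<open>The number is an infimum over positive integers, so 0 must be excluded: with no
    local generators every coefficient of \<open>g\<close> is locally zero, hence zero, contrary to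
    \<open>g\<close> being nonzero.\<close>
  have "k \<noteq> 0"
  proof
    assume k: "k = 0"
    have "coeff (UP R) g n = \<zero>" for n
    proof -
      have "coeff (UP R) g n \<in> {\<zero>}"
      proof (rule R.mem_of_local[OF R.zeroideal])
        fix M assume "maximalideal M R"
        from local_gens[OF this] k have "content R g \<subseteq> saturation R M (Idl {})" by auto
        then show "coeff (UP R) g n \<in> saturation R M {\<zero>}"
          using coeff_mem_content[OF g] by (auto simp: R.Idl_empty)
      qed (use g in simp)
      then show ?thesis by simp
    qed
    then have "g = \<zero>\<^bsub>UP R\<^esub>" using g by (intro up_eqI) auto
    then show False using assms(3) by simp
  qed
  moreover have "polarized_DM R g k"
    unfolding polarized_DM_def
  proof (intro allI impI)
    fix f assume f: "f \<in> {1..k} \<rightarrow> carrier (UP R)"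
    \<comment> \<open>The bound \<open>k\<close> is the same at all maximal ideals, so the inclusion
      can be checked at each of them; the generators \<open>B\<close> and all choices made from them
      may vary with \<open>M\<close>.\<close>
    have "content_prod f k \<cdot> content R g \<subseteq> polarized_sum g f k"
    proof
      fix x assume x: "x \<in> content_prod f k \<cdot> content R g"
      show "x \<in> polarized_sum g f k"
      proof (rule R.mem_of_local[OF polarized_sum_ideal[OF f g]])
        show "x \<in> carrier R"
          using x R.ideal_prod_in_carrier[OF content_prod_ideal[OF f] content_ideal[OF g]] by auto
        fix M assume M: "maximalideal M R"
        from local_gens[OF M] obtain B where B: "finite B" "B \<subseteq> content R g" "card B \<le> k"
          "content R g \<subseteq> saturation R M (Idl B)" by blast
        from content_prod_subset_saturation[OF R.maximalideal_prime[OF M] g f B] x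
        show "x \<in> saturation R M (polarized_sum g f k)" by (rule subsetD)
      qed
    qed
    with polarized_sum_subset[OF f g]
    have "polarized_sum g f k = content_prod f k \<cdot> content R g" by (rule equalityI)
    then show "(\<Oplus>\<^bsub>ideals_set R\<^esub> i \<in> {1..k}. content R (f i \<otimes>\<^bsub>UP R\<^esub> g) \<otimes>\<^bsub>ideals_set R\<^esub>
           (\<Otimes>\<^bsub>ideals_set R\<^esub> j \<in> {1..k} - {i}. content R (f j)))
        = (\<Otimes>\<^bsub>ideals_set R\<^esub> j \<in> {1..k}. content R (f j)) \<otimes>\<^bsub>ideals_set R\<^esub> content R g"
      unfolding R.ideals_set_simps polarized_sum_def content_prod_def .
  qed
  ultimately have "polarized_DM_number R g \<le> enat k"
    unfolding polarized_DM_number_def by (intro INF_lower) auto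
  then show ?thesis using enat by simp
qed

end
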